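(* Let $\{\varepsilon_n : n\ge 1\}$ be i.i.d. random variables with values in $(0,4)$, let $S=(0,1)$, and consider the Markov process on $S$ defined by $X_{n+1}=\varepsilon_{n+1}X_n(1-X_n)$, $n\ge 0$, with $X_0$ an $S$-valued random variable independent of $\{\varepsilon_n : n\ge1\}$. Let $p^{(n)}(x,dy)$ denote its $n$-step transition probability. If the distribution of $\varepsilon_1$ has a nonzero absolutely continuous component (with respect to Lebesgue measure) whose density is bounded away from zero on some nondegenerate interval contained in $(1,4)$ and if, in addition, $$E\log\varepsilon_1>0\quad\text{and}\quad E|\log(4-\varepsilon_1)|<\infty,$$ then $\{X_n : n\ge0\}$ has a unique invariant probability $\pi$ on $S=(0,1)$, and for every $x\in(0,1)$, $\frac1N\sum_{n=1}^N p^{(n)}(x,dy)\to\pi$ in total variation distance as $N\to\infty$.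
   Context: The one-step transition probability on $S=(0,1)$ with its Borel $\sigma$-field is $p(x,B)=P(\varepsilon_1x(1-x)\in B)$. An invariant probability is a probability measure $\pi$ on $S$ with $\pi(B)=\int_S p(x,B)\,\pi(dx)$ for all Borel $B\subset S$. Convergence in total variation distance of $\mu_N$ to $\pi$ means $\sup_{B}|\mu_N(B)-\pi(B)|\to0$, the supremum being over Borel $B\subset S$. *)

theory Defs
  imports "HOL-Probability.Probability"
begin

definition unit_interval_space :: "real measure" where
  "unit_interval_space = restrict_space borel {0<..<1}"

text \<open>
  The kernel \<open>p(x, B) = P(\<epsilon> x (1 - x) \<in> B)\<close>. It is used for \<open>x \<in> (0,1)\<close> and \<open>\<epsilon>\<close> with values
  in \<open>(0,4)\<close>, where \<open>\<epsilon> x (1 - x) \<in> (0,1)\<close>, so that it is a probability kernel.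
\<close>
definition logistic_kernel :: "'w measure \<Rightarrow> ('w \<Rightarrow> real) \<Rightarrow> real \<Rightarrow> real measure" where
  "logistic_kernel M e x = distr M unit_interval_space (\<lambda>\<omega>. e \<omega> * x * (1 - x))"

text \<open>By the Giry bind, \<open>p\<^sup>(\<^sup>n\<^sup>+\<^sup>1\<^sup>)(x, B) = \<integral> p(y, B) p\<^sup>(\<^sup>n\<^sup>)(x, dy)\<close>.\<close>
primrec nstep_kernel :: "'s measure \<Rightarrow> ('s \<Rightarrow> 's measure) \<Rightarrow> nat \<Rightarrow> 's \<Rightarrow> 's measure" where
  "nstep_kernel S p 0 x = return S x"
| "nstep_kernel S p (Suc n) x = bind (nstep_kernel S p n x) p"

definition invariant_probability :: "'s measure \<Rightarrow> ('s \<Rightarrow> 's measure) \<Rightarrow> 's measure \<Rightarrow> bool" where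
  "invariant_probability S p \<pi> \<longleftrightarrow>
     prob_space \<pi> \<and> sets \<pi> = sets S \<and>
     (\<forall>B\<in>sets S. emeasure \<pi> B = (\<integral>\<^sup>+ x. emeasure (p x) B \<partial>\<pi>))"

text \<open>
  Total variation distance on set functions. The supremum is the real one, which is meaningful
  since it is only applied to functions that are bounded by \<open>1\<close>.
\<close>
definition tv_dist :: "'s measure \<Rightarrow> ('s set \<Rightarrow> real) \<Rightarrow> ('s set \<Rightarrow> real) \<Rightarrow> real" where
  "tv_dist S \<mu> \<nu> = (SUP B\<in>sets S. \<bar>\<mu> B - \<nu> B\<bar>)"

definition cesaro_kernel ::
  "'s measure \<Rightarrow> ('s \<Rightarrow> 's measure) \<Rightarrow> nat \<Rightarrow> 's \<Rightarrow> 's set \<Rightarrow> real" where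
  "cesaro_kernel S p N x B = (1 / real N) * (\<Sum>n=1..N. measure (nstep_kernel S p n x) B)"

text \<open>
  \<open>f\<close> is a density of the absolutely continuous component in the Lebesgue decomposition of \<open>\<mu>\<close>;
  \<open>\<nu>\<close> is the component singular to Lebesgue measure.
\<close>
definition ac_component_density :: "real measure \<Rightarrow> (real \<Rightarrow> ennreal) \<Rightarrow> bool" where
  "ac_component_density \<mu> f \<longleftrightarrow>
     f \<in> borel_measurable borel \<and>
     (\<exists>\<nu>. sets \<nu> = sets borel \<and>
        (\<exists>A\<in>sets borel. emeasure lborel A = 0 \<and> emeasure \<nu> (UNIV - A) = 0) \<and>
        (\<forall>B\<in>sets borel. emeasure \<mu> B = emeasure (density lborel f) B + emeasure \<nu> B))"

end

theory Submission
  imports Defs "HOL-Real_Asymp.Real_Asymp"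
begin

text \<open>
  Near a suitable point \<open>z\<close> the kernel dominates \<open>s(y) \<nu>\<close> with \<open>\<nu>\<close> uniform on an interval, so it
  splits as \<open>P = L + s \<otimes> \<nu>\<close>. With \<open>\<Phi>(x) = - ln (x (1 - x))\<close> the drift \<open>P \<Phi> - \<Phi>\<close> equals
  \<open>- E ln \<epsilon> + E (- ln (1 - \<epsilon> x (1 - x)))\<close>, where the last term tends to \<open>0\<close> as \<open>x (1 - x) \<rightarrow> 0\<close>.
  This bounds \<open>H = \<Sum>n. L\<^sup>n 1\<close> by a multiple of \<open>\<Phi> + const\<close>, provided that the support of \<open>s\<close> is reached
  from every point. Then \<open>\<Sum>n. \<nu> L\<^sup>n\<close> is a finite invariant measure. A Cesaro mean \<open>g\<close> of \<open>P\<^sup>n 1\<^sub>B\<close>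
  satisfies \<open>g \<le> P g + 1/N\<close>, and iterating \<open>g \<le> L g + s \<nu>(g) + 1/N\<close> gives \<open>\<bar>g - \<nu>(g)\<bar> \<le> H/N\<close>
  uniformly in \<open>B\<close>.

  Accessibility is Singer's theorem in disguise: a nonempty set invariant under all
  parameters in an open interval contains a periodic cycle of intervals, and since the logistic maps expand
  cross ratios away from \<open>1/2\<close>, the critical orbit must enter this cycle. Hence every point can reach the
  neighbourhood of any cluster point \<open>z\<close> of the critical orbit.
\<close>

section \<open>The critical orbit of the logistic map\<close>

text \<open>Uniqueness is the delicate point: the density is only known to be positive on a possibly
  short parameter interval, and nothing is assumed about the dynamics of a single map, so a priori
  (0,1) could contain several disjoint closed sets for the chain. The critical orbit of one fixed
  parameter supplies a target common to all starting points. The openness of the parameter interval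
  is what makes invariant sets tractable: by wiggling the parameter, the closure of such a set is
  mapped into its interior, so there are intervals to work with. An attracting cycle of intervals
  may make the chain periodic, which is why only Cesaro means converge. The estimates of these means
  are proved from above only; applied to complements of sets they give the bounds from below. The
  second logarithmic moment enters because - ln (1 - \<epsilon> x (1 - x)) is largest at x = 1/2,
  where it equals ln 4 - ln (4 - \<epsilon>).\<close>

definition logistic :: "real \<Rightarrow> real \<Rightarrow> real" where
  "logistic u x = u * x * (1 - x)"

lemma logistic_diff: "logistic u x - logistic u y = u * (x - y) * (1 - x - y)"
  unfolding logistic_def by algebra

lemma isCont_logistic [continuous_intros]: "isCont (logistic u) x"
  unfolding logistic_def by (intro continuous_intros)

lemma continuous_on_logistic_funpow: "continuous_on A (logistic u ^^ n)"
proof -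
  have "isCont (logistic u ^^ n) x" for x
    by (induction n) (auto intro: continuous_at_compose isCont_logistic simp del: o_apply)
  then show ?thesis by (simp add: continuous_at_imp_continuous_on)
qed

lemma logistic_pos: "0 < v \<Longrightarrow> y \<in> {0<..<1} \<Longrightarrow> 0 < logistic v y"
  by (simp add: logistic_def)

lemma le_quarter: "y * (1 - y) \<le> (1/4 :: real)"
proof -
  have "0 \<le> (y - 1/2)^2" by simp
  then show ?thesis by (simp add: power2_eq_square algebra_simps)
qed

text \<open>Images never exceed \<open>b / 4\<close>, which gives the upper end. For the lower end,
  \<open>1 < a\<close> makes 0 repelling: points up to the fixed point \<open>p\<close> of
  \<open>logistic a\<close> are not pushed down, and beyond \<open>p\<close> a unimodal map is
  smallest at an end of the interval. Orbits thus stay in a compact part of (0,1).\<close>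

lemma logistic_trap:
  fixes a b x :: real
  assumes "1 < a" "b < 4" "x \<in> {0<..<1}"
  obtains m M where "0 < m" "m \<le> x" "x \<le> M" "M < 1"
    "\<And>y v. y \<in> {m..M} \<Longrightarrow> v \<in> {a..b} \<Longrightarrow> logistic v y \<in> {m..M}"
proof
  define M where "M = max x (b/4)"
  define p where "p = 1 - 1/a"
  define m where "m = min x (min p (a * (M * (1 - M))))"
  have p: "0 < p" "p < 1" "a * (1 - p) = 1" using assms(1) by (auto simp: p_def)
  have M: "x \<le> M" "b \<le> 4 * M" "0 < M" "M < 1" using assms by (auto simp: M_def)
  show "0 < m" using p M assms by (auto simp: m_def)
  have m: "m \<le> x" "m \<le> p" "m \<le> a * (M * (1 - M))" by (auto simp: m_def)
  then show "m \<le> x" "x \<le> M" "M < 1" using M by auto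
  fix y v assume y: "y \<in> {m..M}" and v: "v \<in> {a..b}"
  have y01: "0 < y" "y < 1" using y \<open>0 < m\<close> M by auto
  have "logistic v y \<le> b * (1/4)"
    unfolding logistic_def mult.assoc using v y01 assms
    by (intro mult_mono le_quarter) auto
  then have up: "logistic v y \<le> M" using M by simp
  have lo: "a * (y * (1 - y)) \<le> logistic v y"
    unfolding logistic_def mult.assoc using v y01 by (intro mult_right_mono) auto
  have "m \<le> a * (y * (1 - y))"
  proof (cases "y \<le> p")
    case True
    have "1 \<le> a * (1 - y)" using p(3) True assms(1)
      by (smt (verit) mult_left_mono)
    then have "y * 1 \<le> y * (a * (1 - y))" using y01 by (intro mult_left_mono) auto
    then show ?thesis using y by (simp add: algebra_simps)
  next
    case False
    show ?thesis
    \<comment> \<open>If this holds, \<open>M\<close> is at least as far from 1/2 as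
      \<open>y\<close>; otherwise \<open>p\<close> is. The image of the further point is the lower
      bound.\<close>
    proof (cases "1 \<le> y + M")
      case True
      have "0 \<le> (M - y) * (y + M - 1)" using True y by auto
      then have "M * (1 - M) \<le> y * (1 - y)" by (simp add: algebra_simps)
      then have "a * (M * (1 - M)) \<le> a * (y * (1 - y))" using assms by (intro mult_left_mono) auto
      then show ?thesis using m by linarith
    next
      case no: False
      have "0 \<le> (y - p) * (1 - y - p)" using False no y by auto
      then have "p * (1 - p) \<le> y * (1 - y)" by (simp add: algebra_simps)
      then have "a * (p * (1 - p)) \<le> a * (y * (1 - y))" using assms by (intro mult_left_mono) auto
      moreover have "a * (p * (1 - p)) = p" using p(3) by (metis mult.left_commute mult.right_neutral)
      ultimately show ?thesis using m by linarith
    qed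
  qed
  then show "logistic v y \<in> {m..M}" using lo up by auto
qed

section \<open>Cross ratios along monotone branches\<close>

definition cross_ratio :: "real \<Rightarrow> real \<Rightarrow> real \<Rightarrow> real \<Rightarrow> real" where
  "cross_ratio a b c d = ((c - a) / (b - a)) * ((d - b) / (d - c))"

text \<open>
  This replaces the negative Schwarzian derivative: with \<open>A = 1/2 - a\<close> etc. the cross ratio gets
  multiplied by \<open>(A + C) (B + D) / ((A + B) (C + D))\<close>, and
  \<open>(A + C) (B + D) - (A + B) (C + D) = (A - D) (B - C)\<close>.
\<close>
lemma cross_ratio_logistic:
  assumes "0 < u"
    and ord: "a < b \<and> b < c \<and> c < d \<or> a > b \<and> b > c \<and> c > d"
    and side: "{a, b, c, d} \<subseteq> {..1/2} \<or> {a, b, c, d} \<subseteq> {1/2..}"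
  shows "cross_ratio a b c d
           < cross_ratio (logistic u a) (logistic u b) (logistic u c) (logistic u d)"
proof -
  define q where "q = ((1 - c - a) * (1 - d - b)) / ((1 - b - a) * (1 - d - c))"
  have eq: "cross_ratio (logistic u a) (logistic u b) (logistic u c) (logistic u d)
     = cross_ratio a b c d * q"
    unfolding cross_ratio_def logistic_diff q_def using assms(1) by (simp add: mult_ac)
  have pos: "0 < (1 - b - a) * (1 - d - c)"
    using side
  proof
    assume "{a, b, c, d} \<subseteq> {..1/2}"
    then show ?thesis using ord by (auto intro!: mult_pos_pos)
  next
    assume "{a, b, c, d} \<subseteq> {1/2..}"
    then show ?thesis using ord by (auto intro!: mult_neg_neg)
  qed
  have "0 < (d - a) * (c - b)"
    using ord by (simp add: zero_less_mult_iff) linarith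
  then have "(1 - b - a) * (1 - d - c) < (1 - c - a) * (1 - d - b)"
    by (simp add: algebra_simps)
  then have q: "1 < q" unfolding q_def using pos by simp
  have "0 < (c - a) / (b - a)" "0 < (d - b) / (d - c)"
    using ord by (auto simp: zero_less_divide_iff)
  then have "0 < cross_ratio a b c d" unfolding cross_ratio_def by (rule mult_pos_pos)
  then show ?thesis using eq q by simp
qed

text \<open>Each factor is 1 plus the middle length over an outer length, so shrinking the middle
  interval while enlarging the outer ones lowers both. This is the configuration that the expansion
  of cross ratios will rule out.\<close>

lemma cross_ratio_antimono:
  assumes "a' \<le> a" "a < b" "b \<le> b'" "b' < c'" "c' \<le> c" "c < d" "d \<le> (d'::real)"
  shows "cross_ratio a' b' c' d' \<le> cross_ratio a b c d"
proof -
  have "(c' - b') / (b' - a') \<le> (c - b) / (b - a)" "(c' - b') / (d' - c') \<le> (c - b) / (d - c)"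
    using assms by (auto intro!: frac_le)
  moreover have "(c - a) / (b - a) = 1 + (c - b) / (b - a)" "(d - b) / (d - c) = 1 + (c - b) / (d - c)"
      "(c' - a') / (b' - a') = 1 + (c' - b') / (b' - a')" "(d' - b') / (d' - c') = 1 + (c' - b') / (d' - c')"
    using assms by (auto simp: field_simps)
  ultimately show ?thesis
    unfolding cross_ratio_def using assms by (auto intro!: mult_mono)
qed

text \<open>No interior point of an interval \<open>I\<close> meets the critical point 1/2 during
  the first \<open>n\<close> steps. The half-lines are closed, so end points of \<open>I\<close> may
  be precritical.\<close>

definition one_sided :: "real \<Rightarrow> nat \<Rightarrow> real set \<Rightarrow> bool" where
  "one_sided u n I \<longleftrightarrow> (\<forall>i<n. (logistic u ^^ i) ` I \<subseteq> {..1/2} \<or> (logistic u ^^ i) ` I \<subseteq> {1/2..})"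

lemma one_sided_strict_monotone:
  assumes "0 < u" "one_sided u n I"
  shows "strict_mono_on I (logistic u ^^ n) \<or> monotone_on I (<) (>) (logistic u ^^ n)"
  using assms(2)
proof (induction n)
  case 0
  then show ?case by (auto simp: strict_mono_on_def)
next
  case (Suc n)
  let ?f = "logistic u ^^ n"
  from Suc.prems have side: "?f ` I \<subseteq> {..1/2} \<or> ?f ` I \<subseteq> {1/2..}" and "one_sided u n I"
    by (auto simp: one_sided_def)
  with Suc.IH have IH: "strict_mono_on I ?f \<or> monotone_on I (<) (>) ?f" by blast
  have less: "logistic u x < logistic u y \<longleftrightarrow> 0 < (y - x) * (1 - y - x)" for x y
  proof -
    have "logistic u y - logistic u x = u * ((y - x) * (1 - y - x))"
      using logistic_diff[of u y x] by (simp add: mult.assoc)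
    then have "0 < logistic u y - logistic u x \<longleftrightarrow> 0 < (y - x) * (1 - y - x)"
      using assms(1) by (simp add: zero_less_mult_iff)
    then show ?thesis by simp
  qed
  from side show ?case
  proof
    assume "?f ` I \<subseteq> {..1/2}"
    then have "x \<in> I \<Longrightarrow> y \<in> I \<Longrightarrow> ?f x < ?f y \<Longrightarrow> logistic u (?f x) < logistic u (?f y)" for x y
      unfolding less by (force intro!: mult_pos_pos)
    then show ?thesis using IH by (auto simp: monotone_on_def)
  next
    assume "?f ` I \<subseteq> {1/2..}"
    then have "x \<in> I \<Longrightarrow> y \<in> I \<Longrightarrow> ?f x < ?f y \<Longrightarrow> logistic u (?f y) < logistic u (?f x)" for x y
      unfolding less by (force intro!: mult_neg_neg)
    then show ?thesis using IH by (auto simp: monotone_on_def)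
  qed
qed

text \<open>The strict gain needs at least one step, so the induction starts at 1. An iterate may
  reverse the order of the four points, which is why the one-step lemma also admits decreasing
  quadruples.\<close>

lemma cross_ratio_logistic_funpow:
  assumes "0 < u" "one_sided u n I" "0 < n"
    and I: "a \<in> I" "b \<in> I" "c \<in> I" "d \<in> I" and ord: "a < b" "b < c" "c < d"
  defines "f \<equiv> logistic u ^^ n"
  shows "cross_ratio a b c d < cross_ratio (f a) (f b) (f c) (f d)"
  using assms(3,2) unfolding f_def
proof (induction n rule: nat_induct_non_zero)
  case 1
  then have "I \<subseteq> {..1/2} \<or> I \<subseteq> {1/2..}" by (auto simp: one_sided_def)
  then show ?case using I ord by (auto intro!: cross_ratio_logistic assms(1))
next
  case (Suc n)
  let ?f = "logistic u ^^ n"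
  from Suc.prems have side: "?f ` I \<subseteq> {..1/2} \<or> ?f ` I \<subseteq> {1/2..}" and os: "one_sided u n I"
    by (auto simp: one_sided_def)
  from one_sided_strict_monotone[OF assms(1) os]
  have "?f a < ?f b \<and> ?f b < ?f c \<and> ?f c < ?f d \<or> ?f a > ?f b \<and> ?f b > ?f c \<and> ?f c > ?f d"
    using I ord by (auto simp: monotone_on_def)
  moreover have "{?f a, ?f b, ?f c, ?f d} \<subseteq> {..1/2} \<or> {?f a, ?f b, ?f c, ?f d} \<subseteq> {1/2..}"
    using side I by blast
  ultimately have "cross_ratio (?f a) (?f b) (?f c) (?f d)
     < cross_ratio (logistic u (?f a)) (logistic u (?f b)) (logistic u (?f c)) (logistic u (?f d))"
    by (intro cross_ratio_logistic assms(1))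
  then show ?case using Suc.IH[OF os] by simp
qed

section \<open>Sets invariant under an open interval of parameters\<close>

lemma iterates_cross:
  fixes h :: "real \<Rightarrow> real"
  assumes cont: "continuous_on {\<alpha>..s} h" and "\<alpha> \<le> s"
    and gt: "\<And>x. x \<in> {\<alpha>..s} \<Longrightarrow> x < h x"
    and mono: "\<And>x. x \<in> {\<alpha>..s} \<Longrightarrow> h x \<le> h s"
  obtains n where "0 < n" "s < (h ^^ n) \<alpha>" "(h ^^ n) \<alpha> \<le> h s"
proof -
  \<comment> \<open>Without fixed points, compactness yields a least advance \<open>\<delta>\<close>
    per step, so the orbit of \<open>\<alpha>\<close> cannot stay below \<open>s\<close>.\<close>
  have "continuous_on {\<alpha>..s} (\<lambda>x. h x - x)" by (intro continuous_intros cont)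
  then obtain z where z: "z \<in> {\<alpha>..s}" "\<And>x. x \<in> {\<alpha>..s} \<Longrightarrow> h z - z \<le> h x - x"
    using continuous_attains_inf[of "{\<alpha>..s}" "\<lambda>x. h x - x"] \<open>\<alpha> \<le> s\<close> by auto
  define \<delta> where "\<delta> = h z - z"
  have \<delta>: "0 < \<delta>" using gt z by (auto simp: \<delta>_def)
  have "\<exists>n. s < (h ^^ n) \<alpha>"
  proof (rule ccontr)
    assume "\<not> ?thesis"
    then have le: "(h ^^ n) \<alpha> \<le> s" for n by (auto simp: not_less)
    have "\<alpha> + real n * \<delta> \<le> (h ^^ n) \<alpha>" for n
    proof (induction n)
      case (Suc n)
      have "\<alpha> \<le> (h ^^ n) \<alpha>" using Suc \<delta> by (smt (verit) mult_nonneg_nonneg of_nat_0_le_iff)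
      then have "\<delta> \<le> h ((h ^^ n) \<alpha>) - (h ^^ n) \<alpha>" using z(2) le unfolding \<delta>_def by auto
      then show ?case using Suc by (simp add: algebra_simps)
    qed simp
    moreover obtain n where "(s - \<alpha>) < real n * \<delta>" using reals_Archimedean3[OF \<delta>] by blast
    ultimately show False using le[of n] by (smt (verit))
  qed
  \<comment> \<open>The step of the first crossing starts from a point still in
    \<open>{\<alpha>..s}\<close>, so it overshoots at most to \<open>h s\<close>.\<close>
  define n where "n = (LEAST n. s < (h ^^ n) \<alpha>)"
  have n: "s < (h ^^ n) \<alpha>" unfolding n_def by (rule LeastI_ex) fact
  have lt: "(h ^^ k) \<alpha> \<le> s" if "k < n" for k
    using not_less_Least[of k "\<lambda>n. s < (h ^^ n) \<alpha>"] that unfolding n_def by auto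
  have n0: "0 < n" using n \<open>\<alpha> \<le> s\<close> by (cases n) auto
  have ge: "\<alpha> \<le> (h ^^ k) \<alpha>" if "k < n" for k
    using that
  proof (induction k)
    case (Suc k)
    then have "(h ^^ k) \<alpha> \<in> {\<alpha>..s}" using lt by auto
    then show ?case using gt Suc by fastforce
  qed simp
  obtain k where k: "n = Suc k" using n0 by (cases n) auto
  have "(h ^^ k) \<alpha> \<in> {\<alpha>..s}" using ge lt k by auto
  then have "(h ^^ n) \<alpha> \<le> h s" using mono k by simp
  with that n0 n show thesis by blast
qed

text \<open>Suppose the critical orbit avoids \<open>R\<close>. A power \<open>h\<close> of the map
  then sends a component \<open>V\<close> of an open part of \<open>R\<close> into itself and is
  increasing on a larger interval bounded by precritical points or by 0 and 1. Cross ratios forbid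
  that both flanks of \<open>V\<close> are pushed outwards, so one flank drifts into
  \<open>V\<close>. Its end point is precritical and carries the critical orbit into
  \<open>R\<close>.\<close>

lemma critical_orbit_enters:
  fixes a b u :: real
  assumes "1 < a" "a < u" "u < b" "b < 4"
    and R: "R \<subseteq> {0<..<1}" "R \<noteq> {}"
    and inv: "\<And>y v. y \<in> R \<Longrightarrow> v \<in> {a<..<b} \<Longrightarrow> logistic v y \<in> R"
  shows "\<exists>n. (logistic u ^^ n) (1/2) \<in> R"
proof (rule ccontr)
  define F where "F = logistic u"
  assume "\<not> ?thesis"
  then have crit: "(F ^^ n) (1/2) \<notin> R" for n by (simp add: F_def)
  have contF: "continuous_on A (F ^^ n)" for A n
    unfolding F_def by (rule continuous_on_logistic_funpow)
  obtain x0 where x0: "x0 \<in> R" using R by auto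
  obtain m M where mM: "0 < m" "m \<le> x0" "x0 \<le> M" "M < 1"
    and trap: "\<And>y v. y \<in> {m..M} \<Longrightarrow> v \<in> {a..b} \<Longrightarrow> logistic v y \<in> {m..M}"
    using logistic_trap[of a b x0] assms x0 by blast
  \<comment> \<open>Cutting with the trap preserves invariance and keeps the closure away from 0 and
    1.\<close>
  define R' where "R' = R \<inter> {m..M}"
  have R'R: "R' \<subseteq> R" and R'mM: "R' \<subseteq> {m..M}" by (auto simp: R'_def)
  have inv': "logistic v y \<in> R'" if "y \<in> R'" "v \<in> {a<..<b}" for y v
    using that inv trap[of y v] by (auto simp: R'_def)
  define U where "U = interior R'"
  have UR: "U \<subseteq> R'" by (simp add: U_def interior_subset)
  have opU: "open U" by (simp add: U_def)
  have clR: "closure R' \<subseteq> {m..M}" using R'mM by (rule closure_minimal) simp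
  \<comment> \<open>For \<open>z\<close> in \<open>R'\<close> close to \<open>y\<close>, letting the
    parameter run through \<open>{a<..<b}\<close> sweeps an open interval of images inside
    \<open>R'\<close> that still contains \<open>F y\<close>.\<close>
  have F_closure: "F y \<in> U" if "y \<in> closure R'" for y
  proof -
    define W where "W = {z. a * (z * (1 - z)) < F y} \<inter> {z. F y < b * (z * (1 - z))}"
    have "y \<in> {m..M}" using that clR by blast
    then have y: "0 < y * (1 - y)" using mM by (intro mult_pos_pos) auto
    have Fy: "F y = u * (y * (1 - y))" by (simp add: F_def logistic_def)
    have "open W" unfolding W_def
      by (intro open_Int open_Collect_less continuous_intros)
    moreover have "y \<in> W"
      unfolding W_def Int_iff mem_Collect_eq Fy using y assms(2,3) by (intro conjI mult_strict_right_mono)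
    ultimately have "W \<inter> R' \<noteq> {}" using that open_Int_closure_eq_empty[of W R'] by auto
    then obtain z where z: "z \<in> W" "z \<in> R'" by blast
    have "z \<in> {m..M}" using z R'mM by blast
    then have g: "0 < z * (1 - z)" using mM by (intro mult_pos_pos) auto
    have "{a * (z * (1 - z)) <..< b * (z * (1 - z))} \<subseteq> R'"
    proof
      fix w assume w: "w \<in> {a * (z * (1 - z)) <..< b * (z * (1 - z))}"
      define v where "v = w / (z * (1 - z))"
      have "w = logistic v z" using g by (auto simp: logistic_def v_def)
      moreover have "v \<in> {a<..<b}"
        unfolding v_def greaterThanLessThan_iff pos_less_divide_eq[OF g] pos_divide_less_eq[OF g]
        using w by simp
      ultimately show "w \<in> R'" using inv'[OF z(2)] by simp
    qed
    moreover have "F y \<in> {a * (z * (1 - z)) <..< b * (z * (1 - z))}" using z by (auto simp: W_def)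
    ultimately show ?thesis unfolding U_def by (intro interiorI[OF open_greaterThanLessThan])
  qed
  have U_cl: "U \<subseteq> closure R'" using UR closure_subset by blast
  have FU: "(F ^^ n) y \<in> U" if "y \<in> U" for n y
  proof (induction n)
    case (Suc n)
    then show ?case using F_closure U_cl by auto
  qed (simp add: that)
  have F_closure': "(F ^^ Suc n) y \<in> U" if "y \<in> closure R'" for n y
    using FU[OF F_closure[OF that], of n] by (simp add: funpow_swap1)
  define E where "E = F ` closure R'"
  have "compact (closure R')" using clR
    by (meson bounded_closed_interval bounded_subset compact_eq_bounded_closed closed_closure)
  then have cE: "compact E" unfolding E_def using contF[of _ 1] by (intro compact_continuous_image) auto
  have "E \<subseteq> U" using F_closure by (auto simp: E_def)
  then obtain e where e: "e > 0" "(\<Union>x\<in>E. ball x e) \<subseteq> U"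
    using compact_subset_open_imp_ball_epsilon_subset[OF cE opU] by blast
  \<comment> \<open>An orbit in the compact set \<open>E\<close> has two terms closer than
    \<open>e\<close>. They lie in one component \<open>V\<close> of \<open>U\<close>, and the time
    \<open>p\<close> between them gives a power of \<open>F\<close> that maps \<open>V\<close> into
    itself.\<close>
  define y where "y n = (F ^^ Suc n) x0" for n
  have x0R: "x0 \<in> R'" using x0 mM by (auto simp: R'_def)
  have FR: "F z \<in> R'" if "z \<in> R'" for z using inv'[OF that, of u] assms by (auto simp: F_def)
  have FnR: "(F ^^ n) x0 \<in> R'" for n using x0R by (induction n) (auto intro: FR)
  have yE: "y n \<in> E" for n using FnR[of n] closure_subset by (auto simp: y_def E_def)
  then obtain l r where lr: "strict_mono (r :: nat \<Rightarrow> nat)" "(y \<circ> r) \<longlonglongrightarrow> l"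
    using cE unfolding compact_def by metis
  then obtain N where N: "\<And>i j. i \<ge> N \<Longrightarrow> j \<ge> N \<Longrightarrow> dist ((y \<circ> r) i) ((y \<circ> r) j) < e"
    using LIMSEQ_imp_Cauchy[OF lr(2)] e(1) unfolding Cauchy_def by meson
  define k where "k = r N"
  define p where "p = r (Suc N) - r N"
  have kp: "r (Suc N) = p + k" and p0: "0 < p"
    using strict_monoD[OF lr(1), of N "Suc N"] by (auto simp: p_def k_def)
  have near: "dist (y k) (y (p + k)) < e" using N[of N "Suc N"] kp by (simp add: k_def)
  have yp: "y (p + k) = (F ^^ p) (y k)" by (simp add: y_def funpow_add funpow_swap1)
  define V where "V = connected_component_set U (y k)"
  have yU: "y k \<in> U" using yE \<open>E \<subseteq> U\<close> by auto
  have ykV: "y k \<in> V" using yU by (simp add: V_def)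
  have VU: "V \<subseteq> U" by (simp add: V_def connected_component_subset)
  have conV: "connected V" by (simp add: V_def)
  have opV: "open V" using opU by (simp add: V_def open_connected_component)
  have V_max: "T \<subseteq> V" if "connected T" "T \<subseteq> U" "T \<inter> V \<noteq> {}" for T
  proof -
    from that(3) obtain z where z: "z \<in> T" "z \<in> V" by blast
    have "connected_component_set U z = V" using z(2) connected_component_eq[of z U "y k"]
      by (simp add: V_def)
    then show ?thesis using connected_component_maximal[OF z(1) that(1,2)] by simp
  qed
  have "y k \<in> ball (y k) e \<inter> V" using e(1) ykV by simp
  then have "ball (y k) e \<subseteq> V" using e(2) yE
    by (intro V_max) (blast intro: convex_connected convex_ball)+
  then have ypV: "(F ^^ p) (y k) \<in> V" using near yp by auto
  have FpV: "(F ^^ p) ` V \<subseteq> V"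
    using ypV ykV VU FU
    by (intro V_max connected_continuous_image conV contF) auto
  define s where "s = Inf V"
  define t where "t = Sup V"
  have VmM: "V \<subseteq> {m..M}" using VU UR R'mM by blast
  have bdd: "bdd_below V" "bdd_above V" using VmM by (meson bdd_below_Icc bdd_above_Icc bdd_below_mono bdd_above_mono)+
  have Veq: "V = {s<..<t}"
  proof (intro equalityI subsetI)
    fix z assume z: "z \<in> V"
    obtain d where d: "d > 0" "ball z d \<subseteq> V" using opV z by (meson open_contains_ball)
    have "z - d/2 \<in> V" "z + d/2 \<in> V" using d by (auto simp: dist_real_def subset_iff)
    then have "s \<le> z - d/2" "z + d/2 \<le> t"
      unfolding s_def t_def by (auto intro: cInf_lower bdd cSup_upper)
    then show "z \<in> {s<..<t}" using d by auto
  next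
    fix z assume z: "z \<in> {s<..<t}"
    obtain v w where "v \<in> V" "v < z" "w \<in> V" "z < w"
      using z ykV cInf_less_iff[OF _ bdd(1)] less_cSup_iff[OF _ bdd(2)]
      unfolding s_def t_def by (metis empty_iff greaterThanLessThan_iff)
    then show "z \<in> V" using conV by (meson connected_contains_Icc atLeastAtMost_iff less_imp_le subsetD)
  qed
  have st: "s < t" using ykV Veq by auto
  have clV: "closure V = {s..t}" using st Veq by simp
  have clVR: "{s..t} \<subseteq> closure R'" using clV VU UR by (metis closure_mono subset_trans)
  then have "{s..t} \<subseteq> {m..M}" using clR by blast
  then have mst: "m \<le> s" "t \<le> M" using st by auto
  \<comment> \<open>An end point in \<open>U\<close> could be joined to \<open>V\<close>, against
    the maximality of a connected component.\<close>
  have sU: "s \<notin> U" and tU: "t \<notin> U"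
  proof -
    show "s \<notin> U"
    proof
      assume "s \<in> U"
      then have "{s..<t} \<subseteq> U" using VU Veq by force
      moreover have "y k \<in> {s..<t} \<inter> V" using ykV Veq by auto
      ultimately have "{s..<t} \<subseteq> V" by (intro V_max) auto
      then show False using Veq st by auto
    qed
    show "t \<notin> U"
    proof
      assume "t \<in> U"
      then have "{s<..t} \<subseteq> U" using VU Veq by force
      moreover have "y k \<in> {s<..t} \<inter> V" using ykV Veq by auto
      ultimately have "{s<..t} \<subseteq> V" by (intro V_max) auto
      then show False using Veq st by auto
    qed
  qed
  \<comment> \<open>The period is doubled so that \<open>h\<close> preserves orientation even if the
    \<open>p\<close>-th iterate reverses it.\<close>
  define q where "q = p + p"
  define h where "h = F ^^ q"
  have hh: "h x = (F ^^ p) ((F ^^ p) x)" for x by (simp add: h_def q_def funpow_add)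
  have q0: "0 < q" using p0 by (simp add: q_def)
  have "h ` V \<subseteq> V" using FpV by (auto simp: hh)
  then have "h ` closure V \<subseteq> closure V"
    using closure_subset by (intro image_closure_subset) (auto simp: h_def contF)
  \<comment> \<open>The image of the closed interval lies in \<open>U\<close>, which omits
    \<open>s\<close> and \<open>t\<close>; hence it avoids both end points.\<close>
  then have hst: "h z \<in> {s<..<t}" if "z \<in> {s..t}" for z
  proof -
    obtain q' where "q = Suc q'" using q0 by (cases q) auto
    then have "h z \<in> U" using F_closure'[of z q'] that clVR by (auto simp: h_def)
    moreover have "h z \<in> {s..t}" using \<open>h ` closure V \<subseteq> closure V\<close> that unfolding clV by blast
    ultimately show ?thesis using sU tU by (auto simp: less_le)
  qed
  \<comment> \<open>These are the turning points of \<open>h\<close>, together with 0 and 1 as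
    stops, so that there is a point of \<open>Z\<close> on either side of \<open>V\<close>. The
    nearest ones become \<open>a'\<close> and \<open>d'\<close>.\<close>
  define Z where "Z = (\<Union>i<q. {z. (F ^^ i) z = 1/2}) \<union> {0, 1}"
  have "closed Z" unfolding Z_def
    by (intro closed_Un closed_UN closed_Collect_eq contF continuous_on_const ballI finite_lessThan) simp
  have Z_precritical: "\<exists>i<q. (F ^^ i) z = 1/2" if "z \<in> Z" "z \<noteq> 0" "z \<noteq> 1" for z
    using that unfolding Z_def by blast
  have precritical_Z: "z \<in> Z" if "i < q" "(F ^^ i) z = 1/2" for i z
    using that unfolding Z_def by blast
  have Z01: "0 \<in> Z" "1 \<in> Z" by (auto simp: Z_def)
  \<comment> \<open>A precritical point in the closure of \<open>V\<close> would have its later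
    images in \<open>R\<close>, among them the image of 1/2.\<close>
  have Zst: "Z \<inter> {s..t} = {}"
  proof -
    have False if "z \<in> {s..t}" "(F ^^ i) z = 1/2" for z i
    proof -
      have "(F ^^ Suc i) z \<in> R" using F_closure' that clVR UR R'R by blast
      then have "(F ^^ 1) (1/2) \<in> R" using that by simp
      then show False using crit by blast
    qed
    moreover have "z \<noteq> 0" "z \<noteq> 1" if "z \<in> {s..t}" for z using that mst mM by auto
    ultimately show ?thesis using Z_precritical by blast
  qed
  define a' where "a' = Sup (Z \<inter> {..s})"
  define d' where "d' = Inf (Z \<inter> {t..})"
  have "a' \<in> Z \<inter> {..s}" unfolding a'_def
  proof (rule closed_contains_Sup)
    show "Z \<inter> {..s} \<noteq> {}" using Z01 mst mM by force
  qed (auto intro: \<open>closed Z\<close>)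
  then have a': "a' \<in> Z" "a' \<le> s" by auto
  have "d' \<in> Z \<inter> {t..}" unfolding d'_def
  proof (rule closed_contains_Inf)
    show "Z \<inter> {t..} \<noteq> {}" using Z01 mst mM by force
  qed (auto intro: \<open>closed Z\<close>)
  then have d': "d' \<in> Z" "t \<le> d'" by auto
  have a's: "a' < s" using a' Zst st by (cases "a' = s") auto
  have td': "t < d'" using d' Zst st by (cases "d' = t") auto
  have noZ: "z \<notin> Z" if "z \<in> {a'<..<d'}" for z
  proof
    assume z: "z \<in> Z"
    consider "z \<le> s" | "z \<in> {s..t}" | "t \<le> z" by force
    then show False
    proof cases
      case 1
      then have "z \<le> a'" using z unfolding a'_def by (intro cSup_upper) auto
      then show False using that by auto
    next
      case 2
      then show False using Zst z by auto
    next
      case 3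
      then have "d' \<le> z" using z unfolding d'_def by (intro cInf_lower) auto
      then show False using that by auto
    qed
  qed
  define I where "I = {a'..d'}"
  have ad': "a' < d'" using a's st td' by simp
  \<comment> \<open>On the open interval each image is connected and misses 1/2, hence lies on one
    side; continuity extends this to the end points.\<close>
  have os: "one_sided u q I"
    unfolding one_sided_def
  proof (intro allI impI)
    fix i assume i: "i < q"
    let ?C = "(F ^^ i) ` {a'<..<d'}"
    have "connected ?C" by (intro connected_continuous_image contF) simp
    moreover have "1/2 \<notin> ?C"
    proof
      assume "1/2 \<in> ?C"
      then obtain z where "z \<in> {a'<..<d'}" "(F ^^ i) z = 1/2" by (metis imageE)
      then show False using noZ precritical_Z i by blast
    qed
    ultimately have side: "?C \<subseteq> {..1/2} \<or> ?C \<subseteq> {1/2..}"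
      using connectedD_interval[of ?C _ _ "1/2"] by (meson atMost_iff atLeast_iff linear subsetI)
    have cl: "I = closure {a'<..<d'}" using ad' by (simp add: I_def)
    from side show "(logistic u ^^ i) ` I \<subseteq> {..1/2} \<or> (logistic u ^^ i) ` I \<subseteq> {1/2..}"
      unfolding F_def[symmetric] cl
      by (metis contF image_closure_subset closed_atMost closed_atLeast)
  qed
  then have osp: "one_sided u p I" by (auto simp: one_sided_def q_def)
  have u0: "0 < u" using assms by simp
  have VI: "V \<subseteq> I" using Veq a's td' by (auto simp: I_def)
  obtain v w where vw: "v \<in> V" "w \<in> V" "v < w"
    using st Veq by (metis dense greaterThanLessThan_iff less_trans)
  have vwI: "v \<in> I" "w \<in> I" "(F ^^ p) v \<in> I" "(F ^^ p) w \<in> I" using vw VI FpV by blast+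
  \<comment> \<open>The \<open>p\<close>-th iterate keeps \<open>V\<close> in \<open>I\<close>, so
    it is applied twice with the same orientation. One pair with \<open>h v < h w\<close> then
    decides the direction of \<open>h\<close> on all of \<open>I\<close>.\<close>
  from one_sided_strict_monotone[OF u0 osp, folded F_def] have "h v < h w"
    unfolding hh using vwI vw(3) by (elim disjE) (auto simp: monotone_on_def)
  moreover from one_sided_strict_monotone[OF u0 os, folded F_def]
  have "strict_mono_on I h \<or> monotone_on I (<) (>) h" unfolding h_def .
  ultimately have "strict_mono_on I h"
    using monotone_onD[of I "(<)" "(>)" h v w] vwI vw(3) by force
  then have mono: "x < y \<Longrightarrow> x \<in> I \<Longrightarrow> y \<in> I \<Longrightarrow> h x < h y" for x y
    by (auto simp: strict_mono_on_def)
  have Imem: "a' \<in> I" "s \<in> I" "t \<in> I" "d' \<in> I" using a's td' st by (auto simp: I_def)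
  have hs: "s < h s" "h s < t" and ht: "s < h t" "h t < t" using hst[of s] hst[of t] st by auto
  \<comment> \<open>Here \<open>h\<close> would move the outer points outwards and \<open>s\<close>,
    \<open>t\<close> inwards, which lowers the cross ratio, whereas \<open>h\<close> strictly raises
    it.\<close>
  have no_expansion: False if "\<alpha> \<in> {a'..<s}" "\<beta> \<in> {t<..d'}" "h \<alpha> \<le> \<alpha>" "\<beta> \<le> h \<beta>" for \<alpha> \<beta>
  proof -
    have I2: "\<alpha> \<in> I" "\<beta> \<in> I" using that a's td' st by (auto simp: I_def)
    have "cross_ratio \<alpha> s t \<beta> < cross_ratio (h \<alpha>) (h s) (h t) (h \<beta>)"
      using cross_ratio_logistic_funpow[OF u0 os q0, of \<alpha> s t \<beta>] I2 Imem that st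
      by (simp add: h_def F_def)
    moreover have "cross_ratio (h \<alpha>) (h s) (h t) (h \<beta>) \<le> cross_ratio \<alpha> s t \<beta>"
      using that hs ht st mono[of s t] Imem by (intro cross_ratio_antimono) auto
    ultimately show False by simp
  qed
  have hn: "(h ^^ n) z = (F ^^ (q * n)) z" for n z by (simp add: h_def funpow_mult)
  \<comment> \<open>The orbit passes through 1/2 at time \<open>i\<close>, before it arrives in
    \<open>V\<close>; so the critical orbit arrives there too.\<close>
  have precritical: False if "i < q" "(F ^^ i) z = 1/2" "0 < n" "(h ^^ n) z \<in> V" for i z n
  proof -
    have "q * 1 \<le> q * n" using that(3) by (intro mult_le_mono2) simp
    with that(1) have "i \<le> q * n" by linarith
    then have "(F ^^ (q * n)) z = (F ^^ (q * n - i)) ((F ^^ i) z)"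
      by (metis comp_apply funpow_add le_add_diff_inverse2)
    then have "(F ^^ (q * n - i)) (1/2) \<in> R" using that VU UR R'R hn by auto
    then show False using crit by blast
  qed
  have F01: "F 0 = 0" "F 1 = 0" by (auto simp: F_def logistic_def)
  then have "(F ^^ n) 0 = 0" for n by (induction n) auto
  then have h01: "h 0 = 0" "h 1 = 0" using q0 F01
    unfolding h_def by (auto simp: gr0_conv_Suc funpow_swap1)
  have conth: "continuous_on A h" for A by (simp add: h_def contF)
  show False
  \<comment> \<open>If the left flank contains no such point, it moves right and \<open>a'\<close>
    climbs into \<open>V\<close>. Otherwise \<open>no_expansion\<close> forces the right flank to
    move left, and the reflection \<open>k\<close> reduces this to the same crossing lemma.\<close>
  proof (cases "\<exists>\<alpha>\<in>{a'..<s}. h \<alpha> \<le> \<alpha>")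
    case False
    then have gt: "x < h x" if "x \<in> {a'..s}" for x using that hs by (cases "x = s") force+
    have le: "h x \<le> h s" if "x \<in> {a'..s}" for x
      using that mono[of x s] Imem td' st by (cases "x = s") (auto simp: I_def)
    obtain n where n: "0 < n" "s < (h ^^ n) a'" "(h ^^ n) a' \<le> h s"
      using iterates_cross[OF conth, of a' s] gt le a's by auto
    have "a' \<noteq> 0" using gt[of a'] a's h01 by auto
    moreover have "a' \<noteq> 1" using a's mst mM st by auto
    ultimately obtain i where "i < q" "(F ^^ i) a' = 1/2" using a' Z_precritical by blast
    moreover have "(h ^^ n) a' \<in> V" using n hs Veq by auto
    ultimately show False using precritical n(1) by blast
  next
    case True
    then have lt: "h x < x" if "x \<in> {t..d'}" for x
      using that ht no_expansion by (cases "x = t") force+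
    have ge: "h t \<le> h x" if "x \<in> {t..d'}" for x
      using that mono[of t x] Imem a's st by (cases "x = t") (auto simp: I_def)
    define k where "k x = - h (- x)" for x
    have k: "(k ^^ n) x = - (h ^^ n) (- x)" for n x by (induction n) (auto simp: k_def)
    have contk: "continuous_on {-d'..-t} k" unfolding k_def
      by (intro continuous_intros continuous_on_compose2[OF conth[of UNIV]]) auto
    have gtk: "x < k x" and gek: "k x \<le> k (- t)" if "x \<in> {-d'..-t}" for x
      using that lt[of "- x"] ge[of "- x"] by (auto simp: k_def)
    obtain n where n: "0 < n" "- t < (k ^^ n) (- d')" "(k ^^ n) (- d') \<le> k (- t)"
      using iterates_cross[OF contk] gtk gek td' by auto
    \<comment> \<open>\<open>h 1 = 0\<close> lies below \<open>h t\<close>, contrary to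
      monotonicity. On the left, \<open>a' = 0\<close> was excluded because \<open>h\<close> fixes
      0.\<close>
    have "d' \<noteq> 1"
      using mono[of t d'] td' Imem ht h01 mst mM by auto
    moreover have "d' \<noteq> 0" using td' mst mM st by auto
    ultimately obtain i where "i < q" "(F ^^ i) d' = 1/2" using d' Z_precritical by blast
    moreover have "(h ^^ n) d' \<in> V" using n ht Veq by (auto simp: k k_def)
    ultimately show False using precritical n(1) by blast
  qed
qed

section \<open>Kernels with a regeneration measure\<close>

text \<open>As operators on nonnegative functions, multi-step kernels become powers, and the
  subprobability kernel of the splitting is treated on the same footing as the Markov
  kernel.\<close>

definition kop :: "('a \<Rightarrow> 'a measure) \<Rightarrow> ('a \<Rightarrow> ennreal) \<Rightarrow> 'a \<Rightarrow> ennreal" where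
  "kop k f x = (\<integral>\<^sup>+ y. f y \<partial>k x)"

locale subkernel =
  fixes S :: "'a measure" and k :: "'a \<Rightarrow> 'a measure"
  assumes kernel: "k \<in> S \<rightarrow>\<^sub>M subprob_algebra S"
begin

lemma sets_kernel_eq: "x \<in> space S \<Longrightarrow> sets (k x) = sets S"
  using measurable_space[OF kernel] by (simp add: space_subprob_algebra)

lemma space_kernel_eq: "x \<in> space S \<Longrightarrow> space (k x) = space S"
  using sets_kernel_eq sets_eq_imp_space_eq by blast

lemma measurable_kernel: "x \<in> space S \<Longrightarrow> f \<in> borel_measurable S \<Longrightarrow> f \<in> borel_measurable (k x)"
  using measurable_cong_sets[OF sets_kernel_eq refl] by blast

lemma kop_measurable: "f \<in> borel_measurable S \<Longrightarrow> kop k f \<in> borel_measurable S"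
  unfolding kop_def by (intro measurable_compose[OF kernel] nn_integral_measurable_subprob_algebra)

lemma pow_measurable: "f \<in> borel_measurable S \<Longrightarrow> (kop k ^^ n) f \<in> borel_measurable S"
  by (induction n) (auto intro: kop_measurable)

lemma kop_indicator: "x \<in> space S \<Longrightarrow> B \<in> sets S \<Longrightarrow> kop k (indicator B) x = emeasure (k x) B"
  by (simp add: kop_def sets_kernel_eq)

lemma kop_mono: "(\<And>y. y \<in> space S \<Longrightarrow> f y \<le> g y) \<Longrightarrow> x \<in> space S \<Longrightarrow> kop k f x \<le> kop k g x"
  unfolding kop_def by (rule nn_integral_mono) (simp add: space_kernel_eq)

lemma pow_mono:
  assumes "\<And>y. y \<in> space S \<Longrightarrow> f y \<le> g y" "x \<in> space S"
  shows "(kop k ^^ n) f x \<le> (kop k ^^ n) g x"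
  using assms(2) by (induction n arbitrary: x) (auto intro: kop_mono assms(1))

lemma pow_cong:
  assumes "\<And>y. y \<in> space S \<Longrightarrow> f y = g y" "x \<in> space S"
  shows "(kop k ^^ n) f x = (kop k ^^ n) g x"
  using assms by (intro antisym pow_mono) auto

lemma kop_cong: "(\<And>y. y \<in> space S \<Longrightarrow> f y = g y) \<Longrightarrow> x \<in> space S \<Longrightarrow> kop k f x = kop k g x"
  using pow_cong[of f g x 1] by simp

lemma pow_add:
  assumes [measurable]: "f \<in> borel_measurable S" "g \<in> borel_measurable S" and "x \<in> space S"
  shows "(kop k ^^ n) (\<lambda>y. f y + g y) x = (kop k ^^ n) f x + (kop k ^^ n) g x"
  using assms(3)
proof (induction n arbitrary: x)
  case (Suc n)
  have "(kop k ^^ Suc n) (\<lambda>y. f y + g y) x = kop k (\<lambda>y. (kop k ^^ n) f y + (kop k ^^ n) g y) x"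
    using Suc by (auto intro: kop_cong)
  also have "\<dots> = (kop k ^^ Suc n) f x + (kop k ^^ Suc n) g x"
    using Suc.prems by (simp add: kop_def nn_integral_add measurable_kernel pow_measurable assms(1,2))
  finally show ?case .
qed simp

lemma pow_cmult:
  assumes [measurable]: "f \<in> borel_measurable S" and "x \<in> space S"
  shows "(kop k ^^ n) (\<lambda>y. c * f y) x = c * (kop k ^^ n) f x"
  using assms(2)
proof (induction n arbitrary: x)
  case (Suc n)
  have "(kop k ^^ Suc n) (\<lambda>y. c * f y) x = kop k (\<lambda>y. c * (kop k ^^ n) f y) x"
    using Suc by (auto intro: kop_cong)
  also have "\<dots> = c * (kop k ^^ Suc n) f x"
    using Suc.prems by (simp add: kop_def nn_integral_cmult measurable_kernel pow_measurable assms(1))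
  finally show ?case .
qed simp

lemma pow_suminf:
  assumes "\<And>i::nat. f i \<in> borel_measurable S" and "x \<in> space S"
  shows "(kop k ^^ n) (\<lambda>y. \<Sum>i. f i y) x = (\<Sum>i. (kop k ^^ n) (f i) x)"
  using assms(2)
proof (induction n arbitrary: x)
  case (Suc n)
  have "(kop k ^^ Suc n) (\<lambda>y. \<Sum>i. f i y) x = kop k (\<lambda>y. \<Sum>i. (kop k ^^ n) (f i) y) x"
    using Suc by (auto intro: kop_cong)
  also have "\<dots> = (\<Sum>i. (kop k ^^ Suc n) (f i) x)"
    using Suc.prems by (simp add: kop_def nn_integral_suminf measurable_kernel pow_measurable assms(1))
  finally show ?case .
qed simp

lemma pow_SUP:
  fixes U :: "nat \<Rightarrow> 'a \<Rightarrow> ennreal"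
  assumes meas: "\<And>i. U i \<in> borel_measurable S" and inc: "incseq U" and "x \<in> space S"
  shows "(kop k ^^ n) (\<lambda>y. SUP i. U i y) x = (SUP i. (kop k ^^ n) (U i) x)"
  using assms(3)
proof (induction n arbitrary: x)
  case (Suc n)
  \<comment> \<open>Monotone convergence wants an increasing sequence on the whole type, but powers
    of the operator are monotone only on the space; hence the value 0 outside.\<close>
  define V where "V i y = (if y \<in> space S then (kop k ^^ n) (U i) y else 0)" for i y
  have "incseq V"
    unfolding V_def incseq_def le_fun_def using inc by (auto intro!: pow_mono simp: incseq_def le_fun_def)
  moreover have "V i \<in> borel_measurable (k x)" for i
    using measurable_kernel[OF Suc.prems pow_measurable[OF meas, of n i]] space_kernel_eq[OF Suc.prems]
    unfolding V_def by (subst measurable_cong[where g="(kop k ^^ n) (U i)"]) auto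
  ultimately have "kop k (\<lambda>y. SUP i. V i y) x = (SUP i. kop k (V i) x)"
    unfolding kop_def by (rule nn_integral_monotone_convergence_SUP)
  moreover have "kop k (V i) x = (kop k ^^ Suc n) (U i) x" for i
    using Suc.prems by (auto simp: V_def intro!: kop_cong)
  moreover have "kop k (\<lambda>y. SUP i. V i y) x = (kop k ^^ Suc n) (\<lambda>y. SUP i. U i y) x"
    using Suc by (auto simp: V_def intro!: kop_cong)
  ultimately show ?case by simp
qed simp

lemma pow_sum:
  assumes "\<And>i. i \<in> A \<Longrightarrow> f i \<in> borel_measurable S" and "x \<in> space S" and "finite A"
  shows "(kop k ^^ n) (\<lambda>y. \<Sum>i\<in>A. f i y) x = (\<Sum>i\<in>A. (kop k ^^ n) (f i) x)"
  using assms(3,1)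
proof (induction A)
  case empty
  show ?case using pow_cmult[of "\<lambda>_. 0" x n 0] assms(2) by simp
next
  case (insert a A)
  have "(kop k ^^ n) (\<lambda>y. \<Sum>i\<in>insert a A. f i y) x = (kop k ^^ n) (\<lambda>y. f a y + (\<Sum>i\<in>A. f i y)) x"
    using insert by simp
  also have "\<dots> = (kop k ^^ n) (f a) x + (kop k ^^ n) (\<lambda>y. \<Sum>i\<in>A. f i y) x"
    using insert.prems assms(2) by (intro pow_add borel_measurable_sum) auto
  finally show ?case using insert by simp
qed

lemma kop_le_1:
  assumes "x \<in> space S" shows "kop k (\<lambda>_. 1) x \<le> 1"
proof -
  interpret subprob_space "k x" using measurable_space[OF kernel assms] by (simp add: space_subprob_algebra)
  show ?thesis using emeasure_space_le_1 by (simp add: kop_def)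
qed

lemma pow_le_1:
  assumes "\<And>y. y \<in> space S \<Longrightarrow> f y \<le> 1" "x \<in> space S"
  shows "(kop k ^^ n) f x \<le> 1"
  using assms(2)
proof (induction n arbitrary: x)
  case (Suc n)
  then have "kop k ((kop k ^^ n) f) x \<le> kop k (\<lambda>_. 1) x" by (intro kop_mono) auto
  with kop_le_1[OF Suc.prems] show ?case by simp
qed (simp add: assms(1))

lemma sets_nstep_kernel:
  assumes "x \<in> space S" shows "sets (nstep_kernel S k n x) = sets S"
proof (induction n)
  case (Suc n)
  then have "space (nstep_kernel S k n x) = space S" by (rule sets_eq_imp_space_eq)
  then show ?case using assms by (auto intro!: sets_bind sets_kernel_eq)
qed simp

text \<open>\<open>bind\<close> appends the last step, so the induction replaces \<open>f\<close> by
  \<open>kop k f\<close> and has to keep \<open>f\<close> general; the resulting power is then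
  reordered.\<close>

lemma nn_integral_nstep_kernel:
  assumes "x \<in> space S" "f \<in> borel_measurable S"
  shows "(\<integral>\<^sup>+ y. f y \<partial>nstep_kernel S k n x) = (kop k ^^ n) f x"
  using assms(2)
proof (induction n arbitrary: f)
  case 0
  then show ?case using assms(1) by (simp add: nn_integral_return)
next
  case (Suc n)
  have "k \<in> nstep_kernel S k n x \<rightarrow>\<^sub>M subprob_algebra S"
    using kernel measurable_cong_sets[OF sets_nstep_kernel[OF assms(1)] refl] by blast
  then have "(\<integral>\<^sup>+ y. f y \<partial>nstep_kernel S k (Suc n) x) = (\<integral>\<^sup>+ y. kop k f y \<partial>nstep_kernel S k n x)"
    using Suc.prems by (simp add: nn_integral_bind kop_def)
  also have "\<dots> = (kop k ^^ Suc n) f x"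
    using Suc.IH[OF kop_measurable[OF Suc.prems]] by (simp add: funpow_swap1)
  finally show ?case .
qed

end

section \<open>Limits and cancellation in the extended nonnegative reals\<close>

lemma LIMSEQ_zero_of_suminf_ennreal:
  fixes f :: "nat \<Rightarrow> ennreal"
  assumes "suminf f < \<top>"
  shows "f \<longlonglongrightarrow> 0"
proof -
  have fin: "f i < \<top>" for i using ennreal_suminf_lessD[OF assms] by blast
  define r where "r i = enn2real (f i)" for i
  have r: "f i = ennreal (r i)" for i using fin by (simp add: r_def)
  have "0 \<le> r i" for i by (simp add: r_def)
  moreover have "(\<Sum>i. ennreal (r i)) \<noteq> \<top>" using assms by (simp add: r[symmetric])
  ultimately have "summable r" by (intro summable_suminf_not_top)
  then have "(\<lambda>i. ennreal (r i)) \<longlonglongrightarrow> ennreal 0"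
    by (intro tendsto_ennrealI summable_LIMSEQ_zero)
  then show ?thesis by (simp add: r[symmetric])
qed

lemma inverse_mult_of_nat: "0 < N \<Longrightarrow> inverse (of_nat N) * of_nat N = (1 :: ennreal)"
  using ennreal_divide_self[of "of_nat N"] of_nat_less_top by (simp add: divide_ennreal_def mult.commute)

lemma inverse_of_nat_mult_LIMSEQ: "h < \<top> \<Longrightarrow> (\<lambda>N. inverse (of_nat N) * h :: ennreal) \<longlonglongrightarrow> 0"
proof -
  assume h: "h < \<top>"
  have "(\<lambda>N. ennreal (enn2real h / real N)) \<longlonglongrightarrow> ennreal 0"
    by (intro tendsto_ennrealI lim_const_over_n)
  moreover have "eventually (\<lambda>N. ennreal (enn2real h / real N) = inverse (of_nat N) * h) sequentially"
    using eventually_gt_at_top[of 0]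
  proof eventually_elim
    case (elim N)
    have "ennreal (enn2real h / real N) = ennreal (enn2real h) / ennreal (real N)"
      using elim by (simp add: divide_ennreal)
    also have "\<dots> = inverse (of_nat N) * h"
      using h by (simp add: divide_ennreal_def ennreal_of_nat_eq_real_of_nat mult.commute)
    finally show ?case .
  qed
  ultimately show ?thesis using tendsto_cong[of "\<lambda>N. ennreal (enn2real h / real N)"] by simp
qed

text \<open>An upper bound for complements becomes a lower bound. Cancelling the finite
  \<open>b'\<close> from a sum avoids truncated subtraction.\<close>

lemma ennreal_complement_le:
  fixes a a' b b' h :: ennreal
  assumes "a + a' = 1" "b + b' = 1" "a' \<le> b' + h"
  shows "b \<le> a + h"
proof -
  have "b' + b = a + a'" using assms(1,2) by (metis add.commute)
  also have "\<dots> \<le> a + (b' + h)" using assms(3) by (rule add_left_mono)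
  also have "\<dots> = b' + (a + h)" by (rule add.left_commute)
  finally have "b' + b \<le> b' + (a + h)" .
  moreover have "b' \<noteq> \<top>"
  proof
    assume "b' = \<top>"
    then show False using assms(2) by simp
  qed
  ultimately show ?thesis unfolding ennreal_add_left_cancel_le by simp
qed

section \<open>Nummelin splitting: from \<open>x\<close> the chain regenerates with probability
  \<open>s x\<close> and law \<open>\<nu>\<close>\<close>

locale split_kernel = p: subkernel S p + l: subkernel S l
  for S :: "'a measure" and p l +
  fixes s :: "'a \<Rightarrow> ennreal" and \<nu> :: "'a measure"
  assumes s_measurable [measurable]: "s \<in> borel_measurable S"
    and \<nu>_prob: "prob_space \<nu>" and sets_\<nu> [measurable_cong]: "sets \<nu> = sets S"
    and p_prob: "\<And>x. x \<in> space S \<Longrightarrow> prob_space (p x)"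
    and split_emeasure: "\<And>x B. x \<in> space S \<Longrightarrow> B \<in> sets S \<Longrightarrow>
          emeasure (p x) B = emeasure (l x) B + s x * emeasure \<nu> B"
begin

abbreviation "P \<equiv> kop p"
abbreviation "L \<equiv> kop l"

lemma space_\<nu>: "space \<nu> = space S"
  using sets_\<nu> by (rule sets_eq_imp_space_eq)

lemma emeasure_\<nu>_space [simp]: "emeasure \<nu> (space \<nu>) = 1" "emeasure \<nu> (space S) = 1"
  using prob_space.emeasure_space_1[OF \<nu>_prob] by (auto simp: space_\<nu>)

lemma measurable_\<nu>: "f \<in> borel_measurable S \<Longrightarrow> f \<in> borel_measurable \<nu>"
  using measurable_cong_sets[OF sets_\<nu> refl] by blast

lemma nn_integral_\<nu>_le_1:
  assumes "\<And>x. x \<in> space S \<Longrightarrow> f x \<le> 1" shows "(\<integral>\<^sup>+ x. f x \<partial>\<nu>) \<le> 1"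
  using nn_integral_mono[of \<nu> f "\<lambda>_. 1"] assms by (simp add: space_\<nu>)

lemma P_split:
  assumes "x \<in> space S" "f \<in> borel_measurable S"
  shows "P f x = L f x + s x * (\<integral>\<^sup>+ y. f y \<partial>\<nu>)"
  using assms(2)
proof (induction rule: borel_measurable_induct)
  case (cong f g)
  have "(\<integral>\<^sup>+ y. f y \<partial>\<nu>) = (\<integral>\<^sup>+ y. g y \<partial>\<nu>)" using cong by (intro nn_integral_cong) (simp add: space_\<nu>)
  then show ?case using cong p.kop_cong[of f g x] l.kop_cong[of f g x] assms(1) by simp
next
  case (set A)
  then show ?case
    by (simp add: p.kop_indicator l.kop_indicator assms(1) split_emeasure sets_\<nu>)
next
  case (mult u c)
  have "(\<integral>\<^sup>+ y. c * u y \<partial>\<nu>) = c * (\<integral>\<^sup>+ y. u y \<partial>\<nu>)"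
    using mult by (intro nn_integral_cmult measurable_\<nu>)
  then show ?case
    using mult p.pow_cmult[of u x 1 c] l.pow_cmult[of u x 1 c] assms(1)
    by (simp add: distrib_left mult.left_commute)
next
  case (add u v)
  have "(\<integral>\<^sup>+ y. v y + u y \<partial>\<nu>) = (\<integral>\<^sup>+ y. v y \<partial>\<nu>) + (\<integral>\<^sup>+ y. u y \<partial>\<nu>)"
    using add by (intro nn_integral_add measurable_\<nu>)
  then show ?case
    using add p.pow_add[of v u x 1] l.pow_add[of v u x 1] assms(1)
    by (simp add: distrib_left ac_simps)
next
  case (seq U)
  have mc: "(\<integral>\<^sup>+ y. (SUP i. U i) y \<partial>M) = (SUP i. \<integral>\<^sup>+ y. U i y \<partial>M)" if "sets M = sets S" for M
  proof -
    have "(\<integral>\<^sup>+ y. (SUP i. U i y) \<partial>M) = (SUP i. \<integral>\<^sup>+ y. U i y \<partial>M)"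
      using seq(1,3) measurable_cong_sets[OF that refl, of borel]
      by (intro nn_integral_monotone_convergence_SUP) (auto simp: incseq_def le_fun_def)
    then show ?thesis by (simp add: image_comp)
  qed
  have inc: "incseq (\<lambda>i. \<integral>\<^sup>+ y. U i y \<partial>M)" for M
    using seq by (intro monoI nn_integral_mono) (auto simp: incseq_def le_fun_def)
  have "(SUP i. L (U i) x) + s x * (SUP i. \<integral>\<^sup>+ y. U i y \<partial>\<nu>) = (SUP i. L (U i) x + s x * (\<integral>\<^sup>+ y. U i y \<partial>\<nu>))"
    unfolding SUP_mult_left_ennreal kop_def
    using inc by (intro ennreal_SUP_add[symmetric]) (auto simp: incseq_def intro: mult_left_mono)
  moreover have "(SUP i. P (U i) x) = (SUP i. L (U i) x + s x * (\<integral>\<^sup>+ y. U i y \<partial>\<nu>))"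
    using seq by (intro SUP_cong refl) auto
  moreover have "P (SUP i. U i) x = (SUP i. P (U i) x)" "L (SUP i. U i) x = (SUP i. L (U i) x)"
    unfolding kop_def by (intro mc p.sets_kernel_eq l.sets_kernel_eq assms(1))+
  ultimately show ?case by (simp only: mc[OF sets_\<nu>])
qed

lemma P_const: "x \<in> space S \<Longrightarrow> P (\<lambda>_. c) x = c"
  using prob_space.emeasure_space_1[OF p_prob] by (simp add: kop_def)

lemma P_pow_const: "x \<in> space S \<Longrightarrow> (P ^^ n) (\<lambda>_. c) x = c"
proof (induction n arbitrary: x)
  case (Suc n)
  then have "P ((P ^^ n) (\<lambda>_. c)) x = P (\<lambda>_. c) x" by (intro p.kop_cong) auto
  then show ?case using P_const Suc by simp
qed simp

lemma L_le_P: "x \<in> space S \<Longrightarrow> f \<in> borel_measurable S \<Longrightarrow> L f x \<le> P f x"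
  by (simp add: P_split)

lemma one_split: "x \<in> space S \<Longrightarrow> 1 = L (\<lambda>_. 1) x + s x"
  using P_split[of x "\<lambda>_. 1"] P_const[of x 1] by simp

lemma s_le_1: "x \<in> space S \<Longrightarrow> s x \<le> 1"
  using add_increasing[OF zero_le order_refl, of "s x" "L (\<lambda>_. 1) x"] one_split[of x] by simp

text \<open>In probabilistic terms \<open>(L ^^ j) s x\<close> is the chance that the first
  regeneration is at step \<open>j + 1\<close>, and the last term is the chance of none in
  \<open>n\<close> steps. Formally, the identity \<open>1 = L 1 + s\<close> is iterated.\<close>

lemma L_pow_split: "x \<in> space S \<Longrightarrow> (\<Sum>j<n. (L ^^ j) s x) + (L ^^ n) (\<lambda>_. 1) x = 1"
proof (induction n)
  case (Suc n)
  have "(L ^^ n) (\<lambda>_. 1) x = (L ^^ n) (\<lambda>y. L (\<lambda>_. 1) y + s y) x"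
    using Suc.prems one_split by (intro l.pow_cong)
  also have "\<dots> = (L ^^ Suc n) (\<lambda>_. 1) x + (L ^^ n) s x"
    using Suc.prems by (simp add: l.pow_add l.kop_measurable funpow_swap1)
  finally show ?case using Suc by (simp add: ac_simps)
qed simp

lemma L_pow_s_le: "x \<in> space S \<Longrightarrow> (\<Sum>j<n. (L ^^ j) s x) \<le> 1"
  using add_increasing2[OF zero_le order_refl, of "\<Sum>j<n. (L ^^ j) s x" "(L ^^ n) (\<lambda>_. 1) x"]
    L_pow_split[of x n] by simp

text \<open>Regenerating at step \<open>n + 1\<close> forces a first regeneration at that step or
  earlier.\<close>

lemma P_pow_s_le: "x \<in> space S \<Longrightarrow> (P ^^ n) s x \<le> (\<Sum>j\<le>n. (L ^^ j) s x)"
proof (induction n arbitrary: x)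
  case (Suc n)
  have "(\<integral>\<^sup>+ y. (P ^^ n) s y \<partial>\<nu>) \<le> 1"
    by (intro nn_integral_\<nu>_le_1 p.pow_le_1 s_le_1)
  then have "(P ^^ Suc n) s x \<le> L ((P ^^ n) s) x + s x"
    using P_split[OF Suc.prems p.pow_measurable[OF s_measurable]]
    by (simp add: add_left_mono mult_left_le)
  also have "L ((P ^^ n) s) x \<le> L (\<lambda>y. \<Sum>j\<le>n. (L ^^ j) s y) x"
    using Suc by (intro l.kop_mono)
  also have "\<dots> = (\<Sum>j\<le>n. (L ^^ Suc j) s x)"
    using l.pow_sum[of "{..n}" "\<lambda>j. (L ^^ j) s" x 1] Suc.prems by (simp add: l.pow_measurable)
  finally show ?case by (subst sum.atMost_Suc_shift) (simp add: add.commute)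
qed simp

text \<open>The \<open>H\<close> of the overview: a sum of survival probabilities, that is, the mean
  time until the first regeneration.\<close>

definition renewals :: "'a \<Rightarrow> ennreal" where
  "renewals x = (\<Sum>n. (L ^^ n) (\<lambda>_. 1) x)"

lemma renewals_measurable [measurable]: "renewals \<in> borel_measurable S"
  unfolding renewals_def[abs_def] by (intro borel_measurable_suminf_order l.pow_measurable) simp

definition cesaro :: "nat \<Rightarrow> ('a \<Rightarrow> ennreal) \<Rightarrow> 'a \<Rightarrow> ennreal" where
  "cesaro N f x = inverse (of_nat N) * (\<Sum>n=1..N. (P ^^ n) f x)"

lemma cesaro_measurable: "f \<in> borel_measurable S \<Longrightarrow> cesaro N f \<in> borel_measurable S"
  unfolding cesaro_def[abs_def]
  by (intro borel_measurable_times_ennreal borel_measurable_const borel_measurable_sum p.pow_measurable)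

lemma cesaro_le_1:
  assumes "\<And>y. y \<in> space S \<Longrightarrow> f y \<le> 1" "x \<in> space S" "0 < N"
  shows "cesaro N f x \<le> 1"
proof -
  have "(\<Sum>n=1..N. (P ^^ n) f x) \<le> (\<Sum>n=1..N. 1)" by (intro sum_mono p.pow_le_1 assms)
  then have "cesaro N f x \<le> inverse (of_nat N) * of_nat N"
    unfolding cesaro_def by (intro mult_left_mono) auto
  then show ?thesis using inverse_mult_of_nat[OF assms(3)] by simp
qed

text \<open>Applying \<open>P\<close> shifts the window of summation by one. The only term lost is
  \<open>P f \<le> 1\<close>, with weight 1/N.\<close>

lemma cesaro_almost_harmonic:
  assumes f: "f \<in> borel_measurable S" "\<And>y. y \<in> space S \<Longrightarrow> f y \<le> 1" and x: "x \<in> space S"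
  shows "cesaro N f x \<le> P (cesaro N f) x + inverse (of_nat N)"
proof -
  have meas: "(\<lambda>y. \<Sum>n=1..N. (P ^^ n) f y) \<in> borel_measurable S"
    by (intro borel_measurable_sum p.pow_measurable f)
  have "P (cesaro N f) x = inverse (of_nat N) * P (\<lambda>y. \<Sum>n=1..N. (P ^^ n) f y) x"
    using p.pow_cmult[OF meas x, of 1 "inverse (of_nat N)"] by (simp add: cesaro_def[abs_def])
  also have "P (\<lambda>y. \<Sum>n=1..N. (P ^^ n) f y) x = (\<Sum>n=1..N. (P ^^ Suc n) f x)"
    using p.pow_sum[of "{1..N}" "\<lambda>n. (P ^^ n) f" x 1] x f by (simp add: p.pow_measurable)
  finally have eq: "P (cesaro N f) x = inverse (of_nat N) * (\<Sum>n=1..N. (P ^^ Suc n) f x)" .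
  have "(\<Sum>n=1..N. (P ^^ n) f x) \<le> (\<Sum>n=1..Suc N. (P ^^ n) f x)" by (intro sum_mono2) auto
  also have "\<dots> = (P ^^ 1) f x + (\<Sum>n=Suc 1..Suc N. (P ^^ n) f x)"
    by (rule sum.atLeast_Suc_atMost) simp
  also have "(\<Sum>n=Suc 1..Suc N. (P ^^ n) f x) = (\<Sum>n=1..N. (P ^^ Suc n) f x)"
    by (rule sum.shift_bounds_cl_Suc_ivl)
  also have "(P ^^ 1) f x \<le> 1" by (intro p.pow_le_1 f x)
  finally have "cesaro N f x \<le> inverse (of_nat N) * (1 + (\<Sum>n=1..N. (P ^^ Suc n) f x))"
    unfolding cesaro_def by (intro mult_left_mono) (simp_all add: add_right_mono)
  then show ?thesis unfolding eq by (simp only: distrib_left mult_1_right add.commute)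
qed

lemma cesaro_compl:
  assumes "B \<in> sets S" "x \<in> space S" "0 < N"
  shows "cesaro N (indicator B) x + cesaro N (indicator (space S - B)) x = 1"
proof -
  have "(P ^^ n) (indicator B) x + (P ^^ n) (indicator (space S - B)) x = 1" for n
  proof -
    have "(P ^^ n) (indicator B) x + (P ^^ n) (indicator (space S - B)) x
        = (P ^^ n) (\<lambda>y. indicator B y + indicator (space S - B) y) x"
      using assms by (intro p.pow_add[symmetric]) auto
    also have "\<dots> = (P ^^ n) (\<lambda>_. 1) x"
      using assms by (intro p.pow_cong) (auto simp: indicator_def)
    finally show ?thesis using P_pow_const assms by simp
  qed
  then have "(\<Sum>n=1..N. (P ^^ n) (indicator B) x) + (\<Sum>n=1..N. (P ^^ n) (indicator (space S - B)) x) = of_nat N"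
    by (simp add: sum.distrib[symmetric])
  then show ?thesis
    using inverse_mult_of_nat[OF assms(3)] unfolding cesaro_def by (simp add: distrib_left[symmetric])
qed

end

section \<open>Drift and invariant probabilities\<close>

text \<open>A Foster-Lyapunov condition with petite set \<open>K\<close>, arranged additively so
  that no extended reals are subtracted. Finiteness of the \<open>\<nu>\<close>-integral of
  \<open>\<Phi>\<close> will make the mean length of a regeneration cycle finite.\<close>

locale drift_kernel = split_kernel S p l s \<nu>
  for S :: "'a measure" and p l s \<nu> +
  fixes \<Phi> :: "'a \<Rightarrow> ennreal" and \<alpha> b \<sigma> :: ennreal and K :: "'a set" and m :: nat
  assumes \<Phi>_measurable [measurable]: "\<Phi> \<in> borel_measurable S"
    and \<Phi>_finite: "\<And>x. x \<in> space S \<Longrightarrow> \<Phi> x < \<top>"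
    and \<Phi>_\<nu>: "(\<integral>\<^sup>+ x. \<Phi> x \<partial>\<nu>) < \<top>"
    and \<alpha>: "0 < \<alpha>" "\<alpha> < \<top>" and b: "b < \<top>" and \<sigma>: "0 < \<sigma>" "\<sigma> < \<top>"
    and K [measurable]: "K \<in> sets S"
    and drift: "\<And>x. x \<in> space S \<Longrightarrow> P \<Phi> x + \<alpha> \<le> \<Phi> x + b * indicator K x"
    and petite: "\<And>x. x \<in> K \<Longrightarrow> \<sigma> \<le> (\<Sum>j\<le>m. (P ^^ j) s x)"
begin

text \<open>Powers of \<open>L\<close> count visits before regeneration, and after each visit
  regeneration is likely within \<open>m + 1\<close> steps, while first regenerations have total
  weight at most 1. One factor \<open>m + 1\<close> comes from replacing each power of
  \<open>P\<close> by a sum of powers of \<open>L\<close>, the other from the overlapping shifts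
  \<open>n + i\<close>; the weight \<open>\<sigma>\<close> is divided out.\<close>

lemma visits_K_bounded:
  assumes "x \<in> space S"
  shows "(\<Sum>n<N. (L ^^ n) (indicator K) x) \<le> of_nat (Suc m) * of_nat (Suc m) / \<sigma>"
proof -
  have K_le: "\<sigma> * indicator K y \<le> of_nat (Suc m) * (\<Sum>i\<le>m. (L ^^ i) s y)" if "y \<in> space S" for y
  proof (cases "y \<in> K")
    case True
    have "\<sigma> \<le> (\<Sum>j\<le>m. (P ^^ j) s y)" using petite True by simp
    also have "\<dots> \<le> (\<Sum>j\<le>m. \<Sum>i\<le>m. (L ^^ i) s y)"
      using P_pow_s_le[OF that] by (intro sum_mono order_trans[OF P_pow_s_le[OF that]] sum_mono2) auto
    finally show ?thesis using True by simp
  qed simp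
  have "\<sigma> * (\<Sum>n<N. (L ^^ n) (indicator K) x) = (\<Sum>n<N. (L ^^ n) (\<lambda>y. \<sigma> * indicator K y) x)"
    using assms by (simp add: sum_distrib_left l.pow_cmult)
  also have "\<dots> \<le> (\<Sum>n<N. (L ^^ n) (\<lambda>y. of_nat (Suc m) * (\<Sum>i\<le>m. (L ^^ i) s y)) x)"
    using assms by (intro sum_mono l.pow_mono K_le)
  also have "\<dots> = (\<Sum>n<N. of_nat (Suc m) * (\<Sum>i\<le>m. (L ^^ n) ((L ^^ i) s) x))"
  proof (rule sum.cong)
    fix n
    have "(L ^^ n) (\<lambda>y. of_nat (Suc m) * (\<Sum>i\<le>m. (L ^^ i) s y)) x
        = of_nat (Suc m) * (L ^^ n) (\<lambda>y. \<Sum>i\<le>m. (L ^^ i) s y) x"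
      by (intro l.pow_cmult assms borel_measurable_sum l.pow_measurable s_measurable)
    also have "(L ^^ n) (\<lambda>y. \<Sum>i\<le>m. (L ^^ i) s y) x = (\<Sum>i\<le>m. (L ^^ n) ((L ^^ i) s) x)"
      by (intro l.pow_sum assms l.pow_measurable s_measurable) simp
    finally show "(L ^^ n) (\<lambda>y. of_nat (Suc m) * (\<Sum>i\<le>m. (L ^^ i) s y)) x
        = of_nat (Suc m) * (\<Sum>i\<le>m. (L ^^ n) ((L ^^ i) s) x)" .
  qed simp
  also have "\<dots> = of_nat (Suc m) * (\<Sum>n<N. \<Sum>i\<le>m. (L ^^ n) ((L ^^ i) s) x)"
    by (rule sum_distrib_left[symmetric])
  also have "(\<Sum>n<N. \<Sum>i\<le>m. (L ^^ n) ((L ^^ i) s) x) = (\<Sum>i\<le>m. \<Sum>n<N. (L ^^ (n + i)) s x)"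
    by (subst sum.swap) (simp add: funpow_add)
  finally have eq: "\<sigma> * (\<Sum>n<N. (L ^^ n) (indicator K) x) \<le> of_nat (Suc m) * (\<Sum>i\<le>m. \<Sum>n<N. (L ^^ (n + i)) s x)" .
  have "(\<Sum>i\<le>m. \<Sum>n<N. (L ^^ (n + i)) s x) \<le> (\<Sum>i\<le>m. 1)"
  proof (rule sum_mono)
    fix i
    have "(\<Sum>n<N. (L ^^ (n + i)) s x) = (\<Sum>n\<in>{i..<N + i}. (L ^^ n) s x)"
      using sum.shift_bounds_nat_ivl[of "\<lambda>n. (L ^^ n) s x" 0 i N] by (simp add: lessThan_atLeast0)
    also have "\<dots> \<le> (\<Sum>n<N + i. (L ^^ n) s x)" by (intro sum_mono2) auto
    also have "\<dots> \<le> 1" by (rule L_pow_s_le[OF assms])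
    finally show "(\<Sum>n<N. (L ^^ (n + i)) s x) \<le> 1" .
  qed
  also have "(\<Sum>i\<le>m. 1 :: ennreal) = of_nat (Suc m)" by simp
  finally have "of_nat (Suc m) * (\<Sum>i\<le>m. \<Sum>n<N. (L ^^ (n + i)) s x) \<le> (of_nat (Suc m) * of_nat (Suc m) :: ennreal)"
    by (rule mult_left_mono) simp
  with eq have "(\<Sum>n<N. (L ^^ n) (indicator K) x) * \<sigma> \<le> of_nat (Suc m) * of_nat (Suc m)"
    unfolding mult.commute[of _ \<sigma>] by (rule order_trans)
  then have "(\<Sum>n<N. (L ^^ n) (indicator K) x) * \<sigma> / \<sigma> \<le> of_nat (Suc m) * of_nat (Suc m) / \<sigma>"
    by (rule divide_right_mono_ennreal)
  then show ?thesis using \<sigma> by (simp add: ennreal_mult_divide_eq del: of_nat_Suc)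
qed

definition drift_bound :: ennreal where "drift_bound = b * (of_nat (Suc m) * of_nat (Suc m) / \<sigma>)"

lemma drift_bound_finite: "drift_bound < \<top>"
proof -
  have "inverse \<sigma> < \<top>" using \<sigma>(1) by (simp add: less_top[symmetric])
  then show ?thesis
    unfolding drift_bound_def divide_ennreal_def using b by (simp add: ennreal_mult_less_top of_nat_less_top del: of_nat_Suc)
qed

text \<open>The drift inequality survives for \<open>L\<close> because
  \<open>L \<Phi> \<le> P \<Phi>\<close>. Telescoping it along the chain killed at regeneration
  leaves \<open>\<Phi> x\<close> plus \<open>b\<close> times the bounded number of visits to
  \<open>K\<close>; the remaining power of \<open>L\<close> on \<open>\<Phi>\<close> is nonnegative
  and dropped.\<close>

lemma renewals_le: "x \<in> space S \<Longrightarrow> \<alpha> * renewals x \<le> \<Phi> x + drift_bound"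
proof -
  assume x: "x \<in> space S"
  have step: "(L ^^ Suc n) \<Phi> x + \<alpha> * (L ^^ n) (\<lambda>_. 1) x \<le> (L ^^ n) \<Phi> x + b * (L ^^ n) (indicator K) x" for n
  proof -
    have "(L ^^ n) (\<lambda>y. L \<Phi> y + \<alpha> * 1) x \<le> (L ^^ n) (\<lambda>y. \<Phi> y + b * indicator K y) x"
      using order_trans[OF add_right_mono[OF L_le_P] drift] by (intro l.pow_mono x) auto
    moreover have "(L ^^ n) (\<lambda>y. L \<Phi> y + \<alpha> * 1) x = (L ^^ Suc n) \<Phi> x + \<alpha> * (L ^^ n) (\<lambda>_. 1) x"
      using l.pow_add[of "L \<Phi>" "\<lambda>_. \<alpha> * 1" x n] l.pow_cmult[of "\<lambda>_. 1" x n \<alpha>] x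
      by (simp add: l.kop_measurable funpow_swap1)
    moreover have "(L ^^ n) (\<lambda>y. \<Phi> y + b * indicator K y) x = (L ^^ n) \<Phi> x + b * (L ^^ n) (indicator K) x"
      using l.pow_add[of "\<Phi>" "\<lambda>y. b * indicator K y" x n] l.pow_cmult[of "indicator K" x n b] x
      by simp
    ultimately show ?thesis by simp
  qed
  have "(L ^^ n) \<Phi> x + \<alpha> * (\<Sum>j<n. (L ^^ j) (\<lambda>_. 1) x) \<le> \<Phi> x + b * (\<Sum>j<n. (L ^^ j) (indicator K) x)" for n
  proof (induction n)
    case (Suc n)
    have "(L ^^ Suc n) \<Phi> x + \<alpha> * (\<Sum>j<Suc n. (L ^^ j) (\<lambda>_. 1) x)
      = ((L ^^ Suc n) \<Phi> x + \<alpha> * (L ^^ n) (\<lambda>_. 1) x) + \<alpha> * (\<Sum>j<n. (L ^^ j) (\<lambda>_. 1) x)"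
      by (simp add: distrib_left ac_simps)
    also have "\<dots> \<le> ((L ^^ n) \<Phi> x + b * (L ^^ n) (indicator K) x) + \<alpha> * (\<Sum>j<n. (L ^^ j) (\<lambda>_. 1) x)"
      by (intro add_right_mono step)
    also have "\<dots> \<le> (\<Phi> x + b * (\<Sum>j<n. (L ^^ j) (indicator K) x)) + b * (L ^^ n) (indicator K) x"
      using add_right_mono[OF Suc, of "b * (L ^^ n) (indicator K) x"] by (simp add: ac_simps)
    finally show ?case by (simp add: distrib_left ac_simps)
  qed simp
  then have "\<alpha> * (\<Sum>j<n. (L ^^ j) (\<lambda>_. 1) x) \<le> \<Phi> x + b * (\<Sum>j<n. (L ^^ j) (indicator K) x)" for n
    by (rule order_trans[OF add_increasing[OF zero_le order_refl]])
  also have "\<Phi> x + b * (\<Sum>j<n. (L ^^ j) (indicator K) x) \<le> \<Phi> x + drift_bound" for n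
    unfolding drift_bound_def by (intro add_left_mono mult_left_mono visits_K_bounded x) simp
  finally have "(\<Sum>j<n. \<alpha> * (L ^^ j) (\<lambda>_. 1) x) \<le> \<Phi> x + drift_bound" for n
    by (simp add: sum_distrib_left)
  then have "(\<Sum>j. \<alpha> * (L ^^ j) (\<lambda>_. 1) x) \<le> \<Phi> x + drift_bound"
    by (intro suminf_le_const) auto
  then show ?thesis by (simp add: renewals_def ennreal_suminf_cmult)
qed

lemma renewals_finite: "x \<in> space S \<Longrightarrow> renewals x < \<top>"
  using order.strict_trans1[OF renewals_le, of x \<top>] \<Phi>_finite[of x] drift_bound_finite \<alpha>
  by (auto simp: ennreal_mult_less_top)

lemma renewals_\<nu>: "(\<integral>\<^sup>+ x. renewals x \<partial>\<nu>) < \<top>"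
proof -
  have "\<alpha> * (\<integral>\<^sup>+ x. renewals x \<partial>\<nu>) = (\<integral>\<^sup>+ x. \<alpha> * renewals x \<partial>\<nu>)"
    by (intro nn_integral_cmult[symmetric] measurable_\<nu> renewals_measurable)
  also have "\<dots> \<le> (\<integral>\<^sup>+ x. \<Phi> x + drift_bound \<partial>\<nu>)"
    by (intro nn_integral_mono renewals_le) (simp add: space_\<nu>)
  also have "\<dots> = (\<integral>\<^sup>+ x. \<Phi> x \<partial>\<nu>) + drift_bound" by (simp add: nn_integral_add measurable_\<nu>)
  also have "\<dots> < \<top>" using \<Phi>_\<nu> drift_bound_finite by simp
  finally show ?thesis using \<alpha> by (auto simp: ennreal_mult_less_top)
qed

lemma L_pow_LIMSEQ: "x \<in> space S \<Longrightarrow> (\<lambda>n. (L ^^ n) (\<lambda>_. 1) x) \<longlonglongrightarrow> 0"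
  using renewals_finite unfolding renewals_def by (rule LIMSEQ_zero_of_suminf_ennreal)

text \<open>After \<open>n\<close> substitutions the integral over \<open>\<nu>\<close> has
  coefficient at most 1 and the error at most \<open>e * renewals x\<close>. The remainder is at
  most the probability of no regeneration in \<open>n\<close> steps, which vanishes because
  \<open>renewals x\<close> is finite.\<close>

lemma almost_harmonic_le:
  assumes g [measurable]: "g \<in> borel_measurable S" and g1: "\<And>y. y \<in> space S \<Longrightarrow> g y \<le> 1"
    and gP: "\<And>y. y \<in> space S \<Longrightarrow> g y \<le> P g y + e" and x: "x \<in> space S"
  shows "g x \<le> (\<integral>\<^sup>+ y. g y \<partial>\<nu>) + e * renewals x"
proof -
  define c where "c = (\<integral>\<^sup>+ y. g y \<partial>\<nu>)"
  have [measurable]: "L g \<in> borel_measurable S" by (rule l.kop_measurable[OF g])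
  have "g x \<le> (L ^^ n) g x + c * (\<Sum>j<n. (L ^^ j) s x) + e * (\<Sum>j<n. (L ^^ j) (\<lambda>_. 1) x)" for n
  proof (induction n)
    case (Suc n)
    have "(L ^^ n) g x \<le> (L ^^ n) (\<lambda>y. (L g y + c * s y) + e * 1) x"
    proof (intro l.pow_mono x)
      fix y assume "y \<in> space S"
      then show "g y \<le> (L g y + c * s y) + e * 1"
        using gP[of y] P_split[OF _ g, of y] by (simp add: c_def mult.commute)
    qed
    also have "\<dots> = (L ^^ n) (\<lambda>y. L g y + c * s y) x + (L ^^ n) (\<lambda>y. e * 1) x"
      by (intro l.pow_add x) measurable
    also have "\<dots> = (L ^^ Suc n) g x + c * (L ^^ n) s x + e * (L ^^ n) (\<lambda>_. 1) x"
      using l.pow_add[of "L g" "\<lambda>y. c * s y" x n] l.pow_cmult[of "\<lambda>_. 1" x n e] l.pow_cmult[of s x n c] x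
      by (simp add: l.kop_measurable funpow_swap1)
    finally have *: "(L ^^ n) g x \<le> \<dots>" .
    show ?case
      by (rule order_trans[OF Suc], rule order_trans[OF add_right_mono[OF add_right_mono[OF *]]])
        (simp add: distrib_left ac_simps)
  qed simp
  moreover have "(L ^^ n) g x \<le> (L ^^ n) (\<lambda>_. 1) x" for n using g1 by (intro l.pow_mono x)
  moreover have "c * (\<Sum>j<n. (L ^^ j) s x) \<le> c * 1" for n by (intro mult_left_mono L_pow_s_le x) simp
  moreover have "e * (\<Sum>j<n. (L ^^ j) (\<lambda>_. 1) x) \<le> e * renewals x" for n
    unfolding renewals_def by (intro mult_left_mono sum_le_suminf) auto
  ultimately have le: "g x \<le> (L ^^ n) (\<lambda>_. 1) x + c * 1 + e * renewals x" for n
    by (meson add_mono order_trans)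
  have "(\<lambda>n. (L ^^ n) (\<lambda>_. 1) x + c * 1 + e * renewals x) \<longlonglongrightarrow> 0 + c * 1 + e * renewals x"
    by (intro tendsto_add tendsto_const L_pow_LIMSEQ x)
  then have "g x \<le> 0 + c * 1 + e * renewals x" using le by (intro LIMSEQ_le_const) auto
  then show ?thesis by (simp add: c_def)
qed

section \<open>Comparison with the starting-point-free values \<open>regen\<close>, uniformly in the
  set\<close>

definition regen :: "nat \<Rightarrow> 'a set \<Rightarrow> ennreal" where
  "regen N B = (\<integral>\<^sup>+ y. cesaro N (indicator B) y \<partial>\<nu>)"

text \<open>The first bound is the almost harmonic estimate; the second is the first one for the
  complement, since both quantities add up to 1 over a set and its complement.\<close>

lemma cesaro_regen:
  assumes "B \<in> sets S" "x \<in> space S" "0 < N"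
  shows "cesaro N (indicator B) x \<le> regen N B + inverse (of_nat N) * renewals x"
    and "regen N B \<le> cesaro N (indicator B) x + inverse (of_nat N) * renewals x"
proof -
  have le: "cesaro N (indicator A) x \<le> regen N A + inverse (of_nat N) * renewals x" if "A \<in> sets S" for A
    unfolding regen_def
  proof (rule almost_harmonic_le)
    have i1: "indicator A y \<le> (1 :: ennreal)" for y by (simp add: indicator_def)
    have iA: "indicator A \<in> borel_measurable S" using that by (rule borel_measurable_indicator)
    show "cesaro N (indicator A) \<in> borel_measurable S" by (rule cesaro_measurable[OF iA])
    show "cesaro N (indicator A) y \<le> 1" if "y \<in> space S" for y
      by (rule cesaro_le_1[OF i1 that assms(3)])
    show "cesaro N (indicator A) y \<le> P (cesaro N (indicator A)) y + inverse (of_nat N)" if "y \<in> space S" for y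
      by (rule cesaro_almost_harmonic[OF iA i1 that])
  qed (rule assms(2))
  then show "cesaro N (indicator B) x \<le> regen N B + inverse (of_nat N) * renewals x" using assms by simp
  have "regen N B + regen N (space S - B)
      = (\<integral>\<^sup>+ y. cesaro N (indicator B) y + cesaro N (indicator (space S - B)) y \<partial>\<nu>)"
    unfolding regen_def using assms
    by (intro nn_integral_add[symmetric] measurable_\<nu> cesaro_measurable) auto
  also have "\<dots> = (\<integral>\<^sup>+ y. 1 \<partial>\<nu>)"
    using assms by (intro nn_integral_cong cesaro_compl) (auto simp: space_\<nu>)
  finally have "regen N B + regen N (space S - B) = 1" by simp
  moreover have "space S - B \<in> sets S" using assms(1) by (rule sets.compl_sets)
  ultimately show "regen N B \<le> cesaro N (indicator B) x + inverse (of_nat N) * renewals x"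
    using ennreal_complement_le[OF cesaro_compl[OF assms] _ le] by blast
qed

text \<open>Truncation at 1 makes the integrand bounded, so that dominated convergence needs no
  integrability of \<open>renewals\<close> under \<open>\<pi>\<close>.\<close>

definition tail :: "'a measure \<Rightarrow> nat \<Rightarrow> ennreal" where
  "tail \<pi> N = (\<integral>\<^sup>+ y. min 1 (inverse (of_nat N) * renewals y) \<partial>\<pi>)"

context
  fixes \<pi> assumes inv: "invariant_probability S p \<pi>"
begin

lemma inv_simps: "prob_space \<pi>" "sets \<pi> = sets S" "space \<pi> = space S"
proof -
  show "prob_space \<pi>" "sets \<pi> = sets S" using inv unfolding invariant_probability_def by auto
  then show "space \<pi> = space S" by (intro sets_eq_imp_space_eq)
qed

lemma inv_measurable: "f \<in> borel_measurable S \<Longrightarrow> f \<in> borel_measurable \<pi>"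
  using measurable_cong_sets[OF inv_simps(2) refl] by blast

lemma inv_P:
  assumes "f \<in> borel_measurable S"
  shows "(\<integral>\<^sup>+ x. P f x \<partial>\<pi>) = (\<integral>\<^sup>+ x. f x \<partial>\<pi>)"
proof -
  have "prob_space \<pi>" by (rule inv_simps)
  have ne: "space \<pi> \<noteq> {}" using inv_simps(1) by (rule prob_space.not_empty)
  have k: "p \<in> \<pi> \<rightarrow>\<^sub>M subprob_algebra S"
    using p.kernel measurable_cong_sets[OF inv_simps(2) refl] by blast
  \<comment> \<open>As an equation between measures, invariance passes from sets to all nonnegative
    measurable functions at once.\<close>
  have "\<pi> = bind \<pi> p"
  proof (rule measure_eqI)
    show "sets \<pi> = sets (bind \<pi> p)"
      using sets_bind[of \<pi> p S] p.sets_kernel_eq ne inv_simps by simp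
    fix B assume "B \<in> sets \<pi>"
    then show "emeasure \<pi> B = emeasure (bind \<pi> p) B"
      using inv emeasure_bind[OF ne k, of B] inv_simps unfolding invariant_probability_def by auto
  qed
  then show ?thesis using nn_integral_bind[OF assms k] by (simp add: kop_def)
qed

lemma inv_P_pow: "f \<in> borel_measurable S \<Longrightarrow> (\<integral>\<^sup>+ x. (P ^^ n) f x \<partial>\<pi>) = (\<integral>\<^sup>+ x. f x \<partial>\<pi>)"
  by (induction n) (auto simp: inv_P p.pow_measurable)

lemma inv_cesaro:
  assumes "B \<in> sets S" "0 < N"
  shows "(\<integral>\<^sup>+ x. cesaro N (indicator B) x \<partial>\<pi>) = emeasure \<pi> B"
proof -
  have meas: "(P ^^ n) (indicator B) \<in> borel_measurable \<pi>" for n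
    using assms by (intro inv_measurable p.pow_measurable) auto
  have "(\<integral>\<^sup>+ x. cesaro N (indicator B) x \<partial>\<pi>)
      = inverse (of_nat N) * (\<Sum>n=1..N. \<integral>\<^sup>+ x. (P ^^ n) (indicator B) x \<partial>\<pi>)"
    unfolding cesaro_def nn_integral_sum[OF meas, symmetric]
    by (intro nn_integral_cmult borel_measurable_sum meas)
  also have "\<dots> = inverse (of_nat N) * of_nat N * emeasure \<pi> B"
    using assms inv_P_pow[of "indicator B"] inv_simps by (simp add: mult.assoc)
  finally show ?thesis using inverse_mult_of_nat[OF assms(2)] by simp
qed

text \<open>Integrating \<open>cesaro_regen\<close> against \<open>\<pi>\<close> turns the Cesaro
  mean into \<open>emeasure \<pi> B\<close>. Since the compared quantities are at most 1, the error
  may be cut at 1 before integrating.\<close>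

lemma inv_regen:
  assumes B: "B \<in> sets S" and N: "0 < N"
  shows "emeasure \<pi> B \<le> regen N B + tail \<pi> N"
    and "regen N B \<le> emeasure \<pi> B + tail \<pi> N"
proof -
  interpret prob_space \<pi> by (rule inv_simps)
  have meas: "(\<lambda>x. min 1 (inverse (of_nat N) * renewals x)) \<in> borel_measurable \<pi>"
    by (intro inv_measurable) measurable
  have cm: "cesaro N (indicator B) \<in> borel_measurable \<pi>"
    using B by (intro inv_measurable cesaro_measurable) auto
  have c1: "cesaro N (indicator B) x \<le> 1" if "x \<in> space S" for x
    using that N by (intro cesaro_le_1) (auto simp: indicator_def)
  have r1: "regen N B \<le> 1" unfolding regen_def using c1 by (intro nn_integral_\<nu>_le_1)
  have "emeasure \<pi> B = (\<integral>\<^sup>+ x. cesaro N (indicator B) x \<partial>\<pi>)" using inv_cesaro[OF B N] by simp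
  also have "\<dots> \<le> (\<integral>\<^sup>+ x. regen N B + min 1 (inverse (of_nat N) * renewals x) \<partial>\<pi>)"
    using cesaro_regen(1)[OF B _ N] c1
    by (intro nn_integral_mono) (auto simp: inv_simps min_def add_increasing)
  also have "\<dots> = regen N B + tail \<pi> N"
    by (simp add: tail_def nn_integral_add meas emeasure_space_1)
  finally show "emeasure \<pi> B \<le> regen N B + tail \<pi> N" .
  have "regen N B = (\<integral>\<^sup>+ x. regen N B \<partial>\<pi>)" by (simp add: emeasure_space_1)
  also have "\<dots> \<le> (\<integral>\<^sup>+ x. cesaro N (indicator B) x + min 1 (inverse (of_nat N) * renewals x) \<partial>\<pi>)"
    using cesaro_regen(2)[OF B _ N] r1
    by (intro nn_integral_mono) (auto simp: inv_simps min_def add_increasing)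
  also have "\<dots> = emeasure \<pi> B + tail \<pi> N"
    unfolding tail_def using inv_cesaro[OF B N] by (simp add: nn_integral_add meas cm)
  finally show "regen N B \<le> emeasure \<pi> B + tail \<pi> N" .
qed

lemma tail_LIMSEQ: "tail \<pi> \<longlonglongrightarrow> 0"
proof -
  interpret prob_space \<pi> by (rule inv_simps)
  have "(\<lambda>N. \<integral>\<^sup>+ y. min 1 (inverse (of_nat N) * renewals y) \<partial>\<pi>) \<longlonglongrightarrow> (\<integral>\<^sup>+ y. 0 \<partial>\<pi>)"
  proof (rule nn_integral_dominated_convergence[where w="\<lambda>_. 1"])
    show "(\<lambda>y. min 1 (inverse (of_nat N) * renewals y)) \<in> borel_measurable \<pi>" for N
      by (intro inv_measurable) measurable
    show "AE y in \<pi>. (\<lambda>N. min 1 (inverse (of_nat N) * renewals y)) \<longlonglongrightarrow> 0"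
    proof (rule AE_I2)
      fix y assume "y \<in> space \<pi>"
      then have "(\<lambda>N. inverse (of_nat N) * renewals y) \<longlonglongrightarrow> 0"
        using renewals_finite inv_simps by (intro inverse_of_nat_mult_LIMSEQ) auto
      then have "(\<lambda>N. min 1 (inverse (of_nat N) * renewals y)) \<longlonglongrightarrow> min 1 0"
        by (intro tendsto_min tendsto_const)
      then show "(\<lambda>N. min 1 (inverse (of_nat N) * renewals y)) \<longlonglongrightarrow> 0" by simp
    qed
  qed (auto simp: emeasure_space_1)
  then show ?thesis by (simp add: tail_def[abs_def])
qed

end

text \<open>Both measures are approximated by the same numbers \<open>regen N B\<close>, with errors
  that tend to 0.\<close>

lemma invariant_probability_unique:
  assumes \<pi>: "invariant_probability S p \<pi>" and \<pi>': "invariant_probability S p \<pi>'"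
  shows "\<pi>' = \<pi>"
proof -
  have le: "emeasure \<rho> B \<le> emeasure \<rho>' B"
    if r: "invariant_probability S p \<rho>" "invariant_probability S p \<rho>'" and B: "B \<in> sets S" for \<rho> \<rho>' B
  proof (rule LIMSEQ_le_const)
    have "(\<lambda>N. emeasure \<rho>' B + tail \<rho>' N + tail \<rho> N) \<longlonglongrightarrow> emeasure \<rho>' B + 0 + 0"
      by (intro tendsto_add tendsto_const tail_LIMSEQ r)
    then show "(\<lambda>N. emeasure \<rho>' B + tail \<rho>' N + tail \<rho> N) \<longlonglongrightarrow> emeasure \<rho>' B" by simp
    have "emeasure \<rho> B \<le> emeasure \<rho>' B + tail \<rho>' N + tail \<rho> N" if "N \<ge> 1" for N
      using order_trans[OF inv_regen(1)[OF r(1) B] add_right_mono[OF inv_regen(2)[OF r(2) B]]] that by simp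
    then show "\<exists>N0. \<forall>N\<ge>N0. emeasure \<rho> B \<le> emeasure \<rho>' B + tail \<rho>' N + tail \<rho> N" by blast
  qed
  show ?thesis
    using inv_simps[OF \<pi>] inv_simps[OF \<pi>'] by (intro measure_eqI antisym le \<pi> \<pi>') auto
qed

lemma cesaro_kernel_eq:
  assumes "x \<in> space S" "B \<in> sets S" "0 < N"
  shows "ennreal (cesaro_kernel S p N x B) = cesaro N (indicator B) x"
proof -
  have e: "ennreal (measure (nstep_kernel S p n x) B) = (P ^^ n) (indicator B) x" for n
  proof -
    have "emeasure (nstep_kernel S p n x) B = (P ^^ n) (indicator B) x"
      using p.nn_integral_nstep_kernel[OF assms(1), of "indicator B" n] assms
      by (simp add: p.sets_nstep_kernel)
    moreover have "(P ^^ n) (indicator B) x \<le> 1"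
      using assms(1) by (intro p.pow_le_1) (auto simp: indicator_def)
    ultimately show ?thesis
      by (metis emeasure_eq_ennreal_measure ennreal_one_neq_top neq_top_trans)
  qed
  have "ennreal (cesaro_kernel S p N x B) = ennreal (\<Sum>n=1..N. measure (nstep_kernel S p n x) B) / ennreal (real N)"
    using assms(3) by (simp add: cesaro_kernel_def divide_ennreal sum_nonneg)
  also have "ennreal (\<Sum>n=1..N. measure (nstep_kernel S p n x) B) = (\<Sum>n=1..N. (P ^^ n) (indicator B) x)"
    by (simp add: sum_ennreal[symmetric] e)
  finally show ?thesis
    by (simp add: cesaro_def ennreal_of_nat_eq_real_of_nat divide_ennreal_def mult.commute)
qed

lemma cesaro_kernel_LIMSEQ:
  assumes \<pi>: "invariant_probability S p \<pi>" and x: "x \<in> space S"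
  shows "(\<lambda>N. tv_dist S (cesaro_kernel S p N x) (measure \<pi>)) \<longlonglongrightarrow> 0"
proof -
  interpret prob_space \<pi> by (rule inv_simps[OF \<pi>])
  \<comment> \<open>The first summand compares the chain from \<open>x\<close> with
    \<open>regen\<close>, the second compares \<open>regen\<close> with \<open>\<pi>\<close>.
    Neither depends on the set, so the bound survives the supremum.\<close>
  define D where "D N = inverse (of_nat N) * renewals x + tail \<pi> N" for N
  have "D \<longlonglongrightarrow> 0 + 0"
    unfolding D_def[abs_def]
    by (intro tendsto_add inverse_of_nat_mult_LIMSEQ renewals_finite x tail_LIMSEQ \<pi>)
  then have D: "D \<longlonglongrightarrow> 0" by simp
  have tail1: "tail \<pi> N \<le> 1" for N
    unfolding tail_def using nn_integral_mono[of \<pi> "\<lambda>y. min 1 (inverse (of_nat N) * renewals y)" "\<lambda>_. 1"]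
    by (simp add: emeasure_space_1)
  have Dfin: "D N < \<top>" if "0 < N" for N
  proof -
    have "tail \<pi> N < \<top>" using tail1 by (rule order.strict_trans1) simp
    moreover have "inverse (of_nat N :: ennreal) < \<top>" using that by (simp add: less_top[symmetric])
    ultimately show ?thesis using renewals_finite[OF x] by (simp add: D_def ennreal_mult_less_top)
  qed
  have "(\<lambda>N. enn2real (D N)) \<longlonglongrightarrow> enn2real 0" using D by (intro tendsto_enn2real) auto
  then have D': "(\<lambda>N. enn2real (D N)) \<longlonglongrightarrow> 0" by simp
  have diff: "\<bar>cesaro_kernel S p N x B - measure \<pi> B\<bar> \<le> enn2real (D N)" if N: "0 < N" and B: "B \<in> sets S" for N B
  proof -
    have ck: "0 \<le> cesaro_kernel S p N x B" by (simp add: cesaro_kernel_def sum_nonneg)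
    have DN: "D N = ennreal (enn2real (D N))" using Dfin[OF N] by simp
    have "ennreal (cesaro_kernel S p N x B) \<le> emeasure \<pi> B + D N"
      using order_trans[OF cesaro_regen(1)[OF B x N] add_right_mono[OF inv_regen(2)[OF \<pi> B N]]]
      by (simp add: cesaro_kernel_eq[OF x B N] D_def ac_simps)
    also have "\<dots> = ennreal (measure \<pi> B + enn2real (D N))"
      by (subst DN) (simp add: emeasure_eq_measure)
    finally have 1: "cesaro_kernel S p N x B \<le> measure \<pi> B + enn2real (D N)"
      by (simp del: ennreal_plus)
    have "ennreal (measure \<pi> B) \<le> ennreal (cesaro_kernel S p N x B) + D N"
      using order_trans[OF inv_regen(1)[OF \<pi> B N] add_right_mono[OF cesaro_regen(2)[OF B x N]]]
      by (simp add: cesaro_kernel_eq[OF x B N] D_def ac_simps emeasure_eq_measure)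
    also have "\<dots> = ennreal (cesaro_kernel S p N x B + enn2real (D N))"
      by (subst DN) (simp add: ck)
    finally have 2: "measure \<pi> B \<le> cesaro_kernel S p N x B + enn2real (D N)"
      using ck by (simp del: ennreal_plus)
    from 1 2 show ?thesis by simp
  qed
  have ne: "sets S \<noteq> {}" by (metis empty_iff sets.empty_sets)
  have upper: "tv_dist S (cesaro_kernel S p N x) (measure \<pi>) \<le> enn2real (D N)" if "0 < N" for N
    unfolding tv_dist_def using diff[OF that] ne by (intro cSUP_least)
  have lower: "0 \<le> tv_dist S (cesaro_kernel S p N x) (measure \<pi>)" if "0 < N" for N
    unfolding tv_dist_def
  proof (rule cSUP_upper2[where x="{}"])
    show "bdd_above ((\<lambda>B. \<bar>cesaro_kernel S p N x B - measure \<pi> B\<bar>) ` sets S)"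
      using diff[OF that] by (auto intro!: bdd_aboveI2)
  qed auto
  show ?thesis
    using D' by (rule tendsto_sandwich[rotated 3, OF _, where f="\<lambda>_. 0"])
      (auto intro: eventually_mono[OF eventually_gt_at_top[of 0]] upper lower)
qed

section \<open>The invariant measure as expected occupation during one regeneration cycle\<close>

definition occupation :: "('a \<Rightarrow> ennreal) \<Rightarrow> ennreal" where
  "occupation f = (\<Sum>n. \<integral>\<^sup>+ x. (L ^^ n) f x \<partial>\<nu>)"

lemma occupation_cong:
  assumes "\<And>x. x \<in> space S \<Longrightarrow> f x = g x" shows "occupation f = occupation g"
  unfolding occupation_def using assms
  by (intro suminf_cong nn_integral_cong l.pow_cong) (auto simp: space_\<nu>)

lemma occupation_add:
  assumes "f \<in> borel_measurable S" "g \<in> borel_measurable S"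
  shows "occupation (\<lambda>y. f y + g y) = occupation f + occupation g"
proof -
  have "(\<integral>\<^sup>+ x. (L ^^ n) (\<lambda>y. f y + g y) x \<partial>\<nu>) = (\<integral>\<^sup>+ x. (L ^^ n) f x \<partial>\<nu>) + (\<integral>\<^sup>+ x. (L ^^ n) g x \<partial>\<nu>)" for n
  proof -
    have "(\<integral>\<^sup>+ x. (L ^^ n) (\<lambda>y. f y + g y) x \<partial>\<nu>) = (\<integral>\<^sup>+ x. (L ^^ n) f x + (L ^^ n) g x \<partial>\<nu>)"
      using assms by (intro nn_integral_cong l.pow_add) (auto simp: space_\<nu>)
    then show ?thesis by (simp add: nn_integral_add measurable_\<nu> l.pow_measurable assms)
  qed
  then show ?thesis unfolding occupation_def by (simp add: suminf_add[symmetric])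
qed

lemma occupation_cmult:
  assumes "f \<in> borel_measurable S"
  shows "occupation (\<lambda>y. c * f y) = c * occupation f"
proof -
  have "(\<integral>\<^sup>+ x. (L ^^ n) (\<lambda>y. c * f y) x \<partial>\<nu>) = c * (\<integral>\<^sup>+ x. (L ^^ n) f x \<partial>\<nu>)" for n
  proof -
    have "(\<integral>\<^sup>+ x. (L ^^ n) (\<lambda>y. c * f y) x \<partial>\<nu>) = (\<integral>\<^sup>+ x. c * (L ^^ n) f x \<partial>\<nu>)"
      using assms by (intro nn_integral_cong l.pow_cmult) (auto simp: space_\<nu>)
    then show ?thesis by (simp add: nn_integral_cmult measurable_\<nu> l.pow_measurable assms)
  qed
  then show ?thesis unfolding occupation_def by simp
qed

lemma occupation_suminf:
  assumes "\<And>i::nat. f i \<in> borel_measurable S"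
  shows "occupation (\<lambda>y. \<Sum>i. f i y) = (\<Sum>i. occupation (f i))"
proof -
  have "(\<integral>\<^sup>+ x. (L ^^ n) (\<lambda>y. \<Sum>i. f i y) x \<partial>\<nu>) = (\<Sum>i. \<integral>\<^sup>+ x. (L ^^ n) (f i) x \<partial>\<nu>)" for n
  proof -
    have "(\<integral>\<^sup>+ x. (L ^^ n) (\<lambda>y. \<Sum>i. f i y) x \<partial>\<nu>) = (\<integral>\<^sup>+ x. (\<Sum>i. (L ^^ n) (f i) x) \<partial>\<nu>)"
      using assms by (intro nn_integral_cong l.pow_suminf) (auto simp: space_\<nu>)
    then show ?thesis by (simp add: nn_integral_suminf measurable_\<nu> l.pow_measurable assms)
  qed
  then show ?thesis
    using nn_integral_suminf[of "\<lambda>i n. \<integral>\<^sup>+ x. (L ^^ n) (f i) x \<partial>\<nu>" "count_space UNIV"]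
    by (simp add: occupation_def nn_integral_count_space_nat)
qed

lemma occupation_SUP:
  fixes U :: "nat \<Rightarrow> 'a \<Rightarrow> ennreal"
  assumes U: "\<And>i. U i \<in> borel_measurable S" "incseq U"
  shows "occupation (\<lambda>y. SUP i. U i y) = (SUP i. occupation (U i))"
proof -
  \<comment> \<open>Set to 0 off the space, to have monotonicity in \<open>i\<close> at every point
    of the type.\<close>
  define V where "V n i y = (if y \<in> space S then (L ^^ n) (U i) y else 0)" for n i y
  have inc: "incseq (V n)" for n
    unfolding V_def incseq_def le_fun_def
    using U(2) by (auto intro!: l.pow_mono simp: incseq_def le_fun_def)
  have meas: "V n i \<in> borel_measurable \<nu>" for n i
    using measurable_\<nu>[OF l.pow_measurable[OF U(1), of n i]]
    unfolding V_def by (subst measurable_cong[where g="(L ^^ n) (U i)"]) (auto simp: space_\<nu>)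
  have V: "(\<integral>\<^sup>+ x. V n i x \<partial>\<nu>) = (\<integral>\<^sup>+ x. (L ^^ n) (U i) x \<partial>\<nu>)" for n i
    by (intro nn_integral_cong) (simp add: V_def space_\<nu>)
  have "(\<integral>\<^sup>+ x. (L ^^ n) (\<lambda>y. SUP i. U i y) x \<partial>\<nu>) = (SUP i. \<integral>\<^sup>+ x. V n i x \<partial>\<nu>)" for n
  proof -
    have "(\<integral>\<^sup>+ x. (L ^^ n) (\<lambda>y. SUP i. U i y) x \<partial>\<nu>) = (\<integral>\<^sup>+ x. (SUP i. V n i x) \<partial>\<nu>)"
      by (intro nn_integral_cong) (auto simp: V_def space_\<nu> l.pow_SUP U)
    also have "\<dots> = (SUP i. \<integral>\<^sup>+ x. V n i x \<partial>\<nu>)"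
      by (intro nn_integral_monotone_convergence_SUP inc meas)
    finally show ?thesis .
  qed
  then have "occupation (\<lambda>y. SUP i. U i y) = (\<Sum>n. SUP i. \<integral>\<^sup>+ x. V n i x \<partial>\<nu>)"
    by (simp add: occupation_def)
  also have "\<dots> = (SUP i. \<Sum>n. \<integral>\<^sup>+ x. V n i x \<partial>\<nu>)"
    using inc by (intro ennreal_suminf_SUP_eq) (auto simp: incseq_def le_fun_def intro!: nn_integral_mono)
  finally show ?thesis by (simp add: V occupation_def)
qed

definition occupation_measure :: "'a measure" where
  "occupation_measure = measure_of (space S) (sets S) (\<lambda>B. occupation (indicator B))"

lemma sets_occupation_measure: "sets occupation_measure = sets S"
  by (simp add: occupation_measure_def sets.sigma_sets_eq)

lemma emeasure_occupation_measure:
  assumes "B \<in> sets S" shows "emeasure occupation_measure B = occupation (indicator B)"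
proof (rule emeasure_measure_of[OF occupation_measure_def])
  show "B \<in> sets occupation_measure" using assms by (simp add: sets_occupation_measure)
  have "occupation (indicator {}) = occupation (\<lambda>_. 0 * 0)" by (intro occupation_cong) simp
  also have "\<dots> = 0" by (subst occupation_cmult) simp_all
  finally have "occupation (indicator {}) = 0" .
  then show "positive (sets occupation_measure) (\<lambda>B. occupation (indicator B))"
    by (simp add: positive_def)
  show "countably_additive (sets occupation_measure) (\<lambda>B. occupation (indicator B))"
  proof (rule countably_additiveI)
    fix A :: "nat \<Rightarrow> 'a set" assume A: "range A \<subseteq> sets occupation_measure" "disjoint_family A"
    have "occupation (indicator (\<Union>i. A i)) = occupation (\<lambda>y. \<Sum>i. indicator (A i) y)"
      by (simp add: suminf_indicator[OF A(2)])
    also have "\<dots> = (\<Sum>i. occupation (indicator (A i)))"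
      using A(1) by (intro occupation_suminf borel_measurable_indicator) (auto simp: sets_occupation_measure)
    finally show "(\<Sum>i. occupation (indicator (A i))) = occupation (indicator (\<Union>i. A i))" by simp
  qed
qed (rule sets.space_closed)

lemma nn_integral_occupation_measure:
  assumes "f \<in> borel_measurable S"
  shows "(\<integral>\<^sup>+ x. f x \<partial>occupation_measure) = occupation f"
proof -
  note s = sets_occupation_measure
  have meas: "g \<in> borel_measurable S \<Longrightarrow> g \<in> borel_measurable occupation_measure" for g
    using measurable_cong_sets[OF s refl] by blast
  from assms show ?thesis
  proof (induction rule: borel_measurable_induct)
    case (cong f g)
    then have "(\<integral>\<^sup>+ x. f x \<partial>occupation_measure) = (\<integral>\<^sup>+ x. g x \<partial>occupation_measure)"
      by (intro nn_integral_cong) (simp add: sets_eq_imp_space_eq[OF s])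
    then show ?case using cong occupation_cong[of f g] by simp
  next
    case (set A)
    then show ?case by (simp add: s emeasure_occupation_measure)
  next
    case (mult u c)
    then show ?case by (simp add: nn_integral_cmult meas occupation_cmult)
  next
    case (add u v)
    then show ?case by (simp add: nn_integral_add meas occupation_add)
  next
    case (seq U)
    have "(\<integral>\<^sup>+ x. (SUP i. U i x) \<partial>occupation_measure) = (SUP i. \<integral>\<^sup>+ x. U i x \<partial>occupation_measure)"
      using seq by (intro nn_integral_monotone_convergence_SUP meas)
    also have "\<dots> = occupation (\<lambda>x. SUP i. U i x)"
      using seq by (simp add: occupation_SUP)
    finally show ?case by (simp add: image_comp SUP_apply[abs_def])
  qed
qed

text \<open>A cycle ends in exactly one regeneration, which is certain because the survival
  probabilities tend to 0.\<close>

lemma occupation_s: "occupation s = 1"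
proof -
  have "(\<Sum>n. (L ^^ n) s x) = 1" if x: "x \<in> space S" for x
  proof -
    have "(\<lambda>n. (\<Sum>j<n. (L ^^ j) s x) + (L ^^ n) (\<lambda>_. 1) x) \<longlonglongrightarrow> (\<Sum>n. (L ^^ n) s x) + 0"
      by (intro tendsto_add L_pow_LIMSEQ x summable_LIMSEQ) simp
    then have "(\<lambda>n. 1 :: ennreal) \<longlonglongrightarrow> (\<Sum>n. (L ^^ n) s x)"
      by (simp add: L_pow_split[OF x])
    then show ?thesis using LIMSEQ_unique tendsto_const by blast
  qed
  then have "(\<integral>\<^sup>+ x. (\<Sum>n. (L ^^ n) s x) \<partial>\<nu>) = (\<integral>\<^sup>+ x. 1 \<partial>\<nu>)"
    by (intro nn_integral_cong) (simp add: space_\<nu>)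
  then show ?thesis
    by (simp add: occupation_def nn_integral_suminf measurable_\<nu> l.pow_measurable)
qed

text \<open>The part \<open>L f\<close> shifts the series by one and loses its first term, the
  integral of \<open>f\<close> over \<open>\<nu>\<close>. The regeneration part of
  \<open>P f\<close> restores it, because \<open>s\<close> has total occupation 1.\<close>

lemma occupation_P:
  assumes "f \<in> borel_measurable S" shows "occupation (P f) = occupation f"
proof -
  have "occupation (P f) = occupation (\<lambda>x. L f x + (\<integral>\<^sup>+ y. f y \<partial>\<nu>) * s x)"
    using assms by (intro occupation_cong) (simp add: P_split mult.commute)
  also have "\<dots> = occupation (L f) + (\<integral>\<^sup>+ y. f y \<partial>\<nu>)"
    using assms by (simp add: occupation_add occupation_cmult l.kop_measurable occupation_s)
  also have "\<dots> = occupation f"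
    unfolding occupation_def using suminf_offset[of "\<lambda>n. \<integral>\<^sup>+ x. (L ^^ n) f x \<partial>\<nu>" 1]
    by (simp add: funpow_swap1 add.commute)
  finally show ?thesis .
qed

lemma invariant_probability_exists: "\<exists>\<pi>. invariant_probability S p \<pi>"
proof -
  define \<mu> where "\<mu> = occupation_measure"
  define t where "t = occupation (\<lambda>_. 1)"
  have sets: "sets \<mu> = sets S" by (simp add: \<mu>_def sets_occupation_measure)
  have space: "space \<mu> = space S" using sets by (rule sets_eq_imp_space_eq)
  have "t = (\<integral>\<^sup>+ x. renewals x \<partial>\<nu>)"
    unfolding t_def occupation_def renewals_def
    by (intro nn_integral_suminf[symmetric] measurable_\<nu> l.pow_measurable) simp
  then have fin: "t < \<top>" using renewals_\<nu> by simp
  \<comment> \<open>The term \<open>n = 0\<close> already contributes 1, so the normalisation does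
    not divide by 0.\<close>
  have "(\<Sum>n<1. \<integral>\<^sup>+ x. (L ^^ n) (\<lambda>_. 1) x \<partial>\<nu>) \<le> t"
    unfolding t_def occupation_def by (intro sum_le_suminf) auto
  then have t1: "1 \<le> t" by simp
  have mass: "emeasure \<mu> (space S) = t"
    using nn_integral_occupation_measure[of "\<lambda>_. 1"] by (simp add: \<mu>_def t_def space[unfolded \<mu>_def])
  have inv_t: "inverse t * t = 1"
    using fin t1 ennreal_divide_self[of t] by (cases "t = 0") (auto simp: divide_ennreal_def mult.commute)
  define \<pi> where "\<pi> = scale_measure (inverse t) \<mu>"
  have "prob_space \<pi>"
    by (rule prob_spaceI) (simp add: \<pi>_def space_scale_measure space mass inv_t)
  moreover have "emeasure \<pi> B = (\<integral>\<^sup>+ x. emeasure (p x) B \<partial>\<pi>)" if B: "B \<in> sets S" for B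
  proof -
    have "(\<integral>\<^sup>+ x. emeasure (p x) B \<partial>\<pi>) = (\<integral>\<^sup>+ x. P (indicator B) x \<partial>\<pi>)"
      using B by (intro nn_integral_cong) (simp add: \<pi>_def space_scale_measure space p.kop_indicator)
    also have "\<dots> = inverse t * occupation (P (indicator B))"
    proof -
      have meas: "P (indicator B) \<in> borel_measurable S" using B by (intro p.kop_measurable) auto
      then have "P (indicator B) \<in> borel_measurable \<mu>" using measurable_cong_sets[OF sets refl] by blast
      then show ?thesis
        using nn_integral_occupation_measure[OF meas] by (simp add: \<pi>_def nn_integral_scale_measure \<mu>_def)
    qed
    also have "\<dots> = emeasure \<pi> B"
      using B by (simp add: occupation_P \<pi>_def \<mu>_def emeasure_occupation_measure)
    finally show ?thesis by simp
  qed
  ultimately show ?thesis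
    unfolding invariant_probability_def using sets by (intro exI[of _ \<pi>]) (simp add: \<pi>_def)
qed

end

section \<open>The random logistic chain\<close>

lemma space_unit_interval: "space unit_interval_space = {0<..<1}"
  by (simp add: unit_interval_space_def space_restrict_space)

lemma sets_unit_interval: "B \<in> sets unit_interval_space \<longleftrightarrow> B \<subseteq> {0<..<1} \<and> B \<in> sets borel"
  unfolding unit_interval_space_def by (subst sets_restrict_space_iff) auto

lemma measurable_unit_interval: "f \<in> borel_measurable borel \<Longrightarrow> f \<in> borel_measurable unit_interval_space"
  unfolding unit_interval_space_def by (rule measurable_restrict_space1)

lemma logistic_in_unit_interval:
  assumes "u \<in> {0<..<4}" "x \<in> {0<..<1}" shows "logistic u x \<in> {0<..<1}"
proof -
  have "logistic u x \<le> u * (1/4)"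
    unfolding logistic_def mult.assoc using assms by (intro mult_left_mono le_quarter) auto
  then show ?thesis using assms logistic_pos[of u x] by auto
qed

locale random_logistic = prob_space M for M :: "'w measure" +
  fixes e :: "'w \<Rightarrow> real" and a b c :: real
  assumes e_measurable [measurable]: "e \<in> borel_measurable M"
    and e_range: "\<And>\<omega>. \<omega> \<in> space M \<Longrightarrow> e \<omega> \<in> {0<..<4}"
    and ab: "1 < a" "a < b" "b < 4" and c_pos: "0 < c"
    and minor: "\<And>B. B \<in> sets borel \<Longrightarrow> B \<subseteq> {a<..<b} \<Longrightarrow>
          ennreal c * emeasure lborel B \<le> emeasure (distr M borel e) B"
    and log_pos: "0 < expectation (\<lambda>\<omega>. ln (e \<omega>))"
    and log4: "(\<integral>\<^sup>+ \<omega>. ennreal \<bar>ln (4 - e \<omega>)\<bar> \<partial>M) < \<infinity>"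
begin

abbreviation "S \<equiv> unit_interval_space"
abbreviation "p \<equiv> logistic_kernel M e"
abbreviation "T \<equiv> kop p"

lemma kernel_arg_measurable:
  assumes "x \<in> {0<..<1}" shows "(\<lambda>\<omega>. e \<omega> * x * (1 - x)) \<in> M \<rightarrow>\<^sub>M S"
  unfolding unit_interval_space_def
  using logistic_in_unit_interval[OF e_range assms]
  by (intro measurable_restrict_space2) (auto simp: logistic_def)

lemma sets_p [simp]: "sets (p x) = sets S"
  by (simp add: logistic_kernel_def)

lemma prob_space_p: "x \<in> {0<..<1} \<Longrightarrow> prob_space (p x)"
  unfolding logistic_kernel_def by (intro prob_space_distr kernel_arg_measurable)

lemma p_kernel: "p \<in> S \<rightarrow>\<^sub>M subprob_algebra S"
  unfolding logistic_kernel_def[abs_def]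
proof (rule measurable_distr2)
  have [measurable]: "(\<lambda>x. x) \<in> borel_measurable S" by (intro measurable_unit_interval) simp
  have "(\<lambda>z. e (snd z) * fst z * (1 - fst z)) \<in> borel_measurable (S \<Otimes>\<^sub>M M)" by measurable
  moreover have "(\<lambda>z. e (snd z) * fst z * (1 - fst z)) \<in> space (S \<Otimes>\<^sub>M M) \<rightarrow> {0<..<1}"
    using logistic_in_unit_interval[OF e_range]
    by (auto simp: space_pair_measure space_unit_interval logistic_def)
  ultimately show "(\<lambda>(x, \<omega>). e \<omega> * x * (1 - x)) \<in> S \<Otimes>\<^sub>M M \<rightarrow>\<^sub>M S"
    unfolding unit_interval_space_def[of] split_beta' by (intro measurable_restrict_space2)
  show "(\<lambda>x. M) \<in> S \<rightarrow>\<^sub>M subprob_algebra M"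
    by (intro measurable_const) (simp add: space_subprob_algebra prob_space_imp_subprob_space prob_space_axioms)
qed

sublocale p: subkernel S p
  by standard (rule p_kernel)

lemma P_eq:
  assumes "x \<in> {0<..<1}" "f \<in> borel_measurable S"
  shows "T f x = (\<integral>\<^sup>+ \<omega>. f (logistic (e \<omega>) x) \<partial>M)"
  unfolding kop_def logistic_kernel_def logistic_def
  by (intro nn_integral_distr kernel_arg_measurable assms) (use assms in simp)

text \<open>Every parameter in \<open>{a<..<b}\<close> lies in the support of \<open>e\<close>,
  since the minorization gives positive mass to each small interval around it.\<close>

lemma hit_pos:
  assumes "u \<in> {a<..<b}" "open A" "u \<in> A"
  shows "0 < emeasure M {\<omega> \<in> space M. e \<omega> \<in> A}"
proof -
  obtain \<eta> where \<eta>: "0 < \<eta>" "ball u \<eta> \<subseteq> A \<inter> {a<..<b}"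
    using assms open_Int[of A "{a<..<b}"] by (meson IntI open_contains_ball open_greaterThanLessThan)
  have "0 < ennreal c * emeasure lborel {u - \<eta> <..< u + \<eta>}"
    using \<eta> c_pos by (simp add: ennreal_zero_less_mult_iff)
  also have "\<dots> \<le> emeasure (distr M borel e) {u - \<eta> <..< u + \<eta>}"
    using \<eta> by (intro minor) (auto simp: ball_eq_greaterThanLessThan)
  also have "\<dots> = emeasure M (e -` {u - \<eta> <..< u + \<eta>} \<inter> space M)"
    by (intro emeasure_distr) auto
  also have "\<dots> \<le> emeasure M {\<omega> \<in> space M. e \<omega> \<in> A}"
  proof (rule emeasure_mono)
    have [measurable]: "A \<in> sets borel" using assms(2) by simp
    show "{\<omega> \<in> space M. e \<omega> \<in> A} \<in> events" by measurable
  qed (use \<eta> in \<open>auto simp: ball_eq_greaterThanLessThan\<close>)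
  finally show ?thesis .
qed

section \<open>Drift of the logarithmic Lyapunov function\<close>

definition \<Phi> :: "real \<Rightarrow> ennreal" where "\<Phi> x = ennreal (- ln (x * (1 - x)))"
definition \<gamma> :: real where "\<gamma> = expectation (\<lambda>\<omega>. ln (e \<omega>))"
text \<open>With \<open>g = x * (1 - x)\<close>, the value of \<open>\<Phi>\<close> after one step
  is \<open>- ln (e \<omega>) - ln g + \<zeta> g \<omega>\<close>, so the drift at \<open>x\<close>
  is \<open>h g - \<gamma>\<close>.\<close>

definition \<zeta> :: "real \<Rightarrow> 'w \<Rightarrow> real" where "\<zeta> g \<omega> = - ln (1 - e \<omega> * g)"
definition h :: "real \<Rightarrow> real" where "h g = expectation (\<zeta> g)"

lemma \<zeta>_measurable [measurable]: "\<zeta> g \<in> borel_measurable M"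
  unfolding \<zeta>_def[abs_def] by measurable

lemma \<zeta>_mono:
  assumes "\<omega> \<in> space M" "0 \<le> g" "g \<le> g'" "g' \<le> 1/4"
  shows "\<zeta> g \<omega> \<le> \<zeta> g' \<omega>"
proof -
  have "e \<omega> * g \<le> e \<omega> * g'" "e \<omega> * g' \<le> e \<omega> * (1/4)"
    using assms e_range[OF assms(1)] by (auto intro: mult_left_mono)
  moreover have "0 < e \<omega>" "e \<omega> < 4" using e_range[OF assms(1)] by auto
  ultimately have "0 < 1 - e \<omega> * g'" "1 - e \<omega> * g' \<le> 1 - e \<omega> * g" by linarith+
  then show ?thesis unfolding \<zeta>_def by (simp only: neg_le_iff_le ln_mono)
qed

lemma \<zeta>_nonneg: "\<omega> \<in> space M \<Longrightarrow> 0 \<le> g \<Longrightarrow> g \<le> 1/4 \<Longrightarrow> 0 \<le> \<zeta> g \<omega>"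
  using \<zeta>_mono[of \<omega> 0 g] by (simp add: \<zeta>_def)

text \<open>Since \<open>1 - e \<omega> / 4 = (4 - e \<omega>) / 4\<close>, this is where the moment
  condition on ln (4 - \<epsilon>) enters. By monotonicity it controls all other
  \<open>g\<close>.\<close>

lemma integrable_\<zeta>_quarter: "integrable M (\<zeta> (1/4))"
proof -
  have "integrable M (\<lambda>\<omega>. \<bar>ln (4 - e \<omega>)\<bar>)"
    using log4 by (intro integrableI_bounded) auto
  moreover have "(\<lambda>\<omega>. ln (4 - e \<omega>)) \<in> borel_measurable M" by measurable
  ultimately have "integrable M (\<lambda>\<omega>. ln (4 - e \<omega>))" by (simp only: integrable_abs_iff)
  then have "integrable M (\<lambda>\<omega>. ln 4 - ln (4 - e \<omega>))"
    by (intro Bochner_Integration.integrable_diff integrable_const)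
  also have "?this \<longleftrightarrow> integrable M (\<zeta> (1/4))"
  proof (rule Bochner_Integration.integrable_cong[OF refl])
    fix \<omega> assume "\<omega> \<in> space M"
    then have "0 < 4 - e \<omega>" using e_range by auto
    then have "ln ((4 - e \<omega>) / 4) = ln (4 - e \<omega>) - ln 4" by (intro ln_divide_pos) auto
    moreover have "(4 - e \<omega>) / 4 = 1 - e \<omega> * (1/4)" by simp
    ultimately show "ln 4 - ln (4 - e \<omega>) = \<zeta> (1/4) \<omega>" unfolding \<zeta>_def by simp
  qed
  finally show ?thesis .
qed

lemma integrable_\<zeta>:
  assumes "0 \<le> g" "g \<le> 1/4" shows "integrable M (\<zeta> g)"
  using \<zeta>_mono[OF _ assms(1,2)] \<zeta>_nonneg[OF _ assms]
  by (intro Bochner_Integration.integrable_bound[OF integrable_\<zeta>_quarter] AE_I2)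
     (auto intro: order_trans[OF _ abs_ge_self])

lemma h_mono: "0 \<le> g \<Longrightarrow> g \<le> g' \<Longrightarrow> g' \<le> 1/4 \<Longrightarrow> h g \<le> h g'"
  unfolding h_def by (intro integral_mono integrable_\<zeta> \<zeta>_mono) auto

lemma h_nonneg: "0 \<le> g \<Longrightarrow> g \<le> 1/4 \<Longrightarrow> 0 \<le> h g"
  unfolding h_def by (intro Bochner_Integration.integral_nonneg \<zeta>_nonneg) auto

lemma h_small: "\<exists>g0>0. g0 \<le> 1/4 \<and> h g0 \<le> \<gamma> / 2"
proof -
  \<comment> \<open>Any sequence tending to 0 within (0, 1/4] serves; \<open>\<zeta> (1/4)\<close>
    dominates along it.\<close>
  define r where "r n = 1 / (4 * real (Suc n))" for n
  have r: "0 < r n" "r n \<le> 1/4" for n by (auto simp: r_def field_simps)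
  have r0: "r \<longlonglongrightarrow> 0"
    unfolding r_def[abs_def] by real_asymp
  have "(\<lambda>n. h (r n)) \<longlonglongrightarrow> expectation (\<lambda>_. 0)"
    unfolding h_def
  proof (rule integral_dominated_convergence[where w="\<zeta> (1/4)"])
    show "AE \<omega> in M. (\<lambda>n. \<zeta> (r n) \<omega>) \<longlonglongrightarrow> 0"
    proof (rule AE_I2)
      fix \<omega>
      have "(\<lambda>n. - ln (1 - e \<omega> * r n)) \<longlonglongrightarrow> - ln (1 - e \<omega> * 0)"
        by (intro tendsto_intros r0) auto
      then show "(\<lambda>n. \<zeta> (r n) \<omega>) \<longlonglongrightarrow> 0" by (simp add: \<zeta>_def)
    qed
    show "AE \<omega> in M. norm (\<zeta> (r n) \<omega>) \<le> \<zeta> (1/4) \<omega>" for n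
      using \<zeta>_mono[of _ "r n" "1/4"] \<zeta>_nonneg[of _ "r n"] r[of n] by (intro AE_I2) auto
  qed (auto simp: integrable_\<zeta>_quarter)
  then have "(\<lambda>n. h (r n)) \<longlonglongrightarrow> 0" by simp
  moreover have "0 < \<gamma> / 2" using log_pos by (simp add: \<gamma>_def)
  ultimately have "eventually (\<lambda>n. h (r n) < \<gamma> / 2) sequentially" by (rule order_tendstoD)
  then obtain n where "h (r n) < \<gamma> / 2" by (auto simp: eventually_sequentially)
  then show ?thesis using r by (intro exI[of _ "r n"]) auto
qed

lemma \<Phi>_measurable: "\<Phi> \<in> borel_measurable S"
  unfolding \<Phi>_def[abs_def] by (intro measurable_unit_interval) measurable

text \<open>The second part matters because \<open>ennreal\<close> truncates negative reals to 0; it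
  makes the later addition of \<gamma>/2 exact.\<close>

lemma P_\<Phi>:
  assumes x: "x \<in> {0<..<1}"
  shows "T \<Phi> x = ennreal (- \<gamma> - ln (x * (1 - x)) + h (x * (1 - x)))"
    and "0 \<le> - \<gamma> - ln (x * (1 - x)) + h (x * (1 - x))"
proof -
  define g where "g = x * (1 - x)"
  have g: "0 < g" "g \<le> 1/4" using x le_quarter by (auto simp: g_def)
  \<comment> \<open>A non-integrable function has Bochner integral 0, so a positive expectation
    implies integrability.\<close>
  have il: "integrable M (\<lambda>\<omega>. ln (e \<omega>))"
    using log_pos not_integrable_integral_eq by fastforce
  define U where "U \<omega> = - ln (e \<omega>) - ln g + \<zeta> g \<omega>" for \<omega>
  have U: "- ln (logistic (e \<omega>) x * (1 - logistic (e \<omega>) x)) = U \<omega>" "0 \<le> U \<omega>" if "\<omega> \<in> space M" for \<omega>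
  proof -
    have l: "logistic (e \<omega>) x \<in> {0<..<1}" by (intro logistic_in_unit_interval e_range x that)
    have e0: "0 < e \<omega>" using e_range[OF that] by simp
    have le: "logistic (e \<omega>) x = e \<omega> * g" by (simp add: logistic_def g_def)
    have "ln (logistic (e \<omega>) x * (1 - logistic (e \<omega>) x)) = ln (e \<omega> * g) + ln (1 - e \<omega> * g)"
      using l unfolding le by (intro ln_mult_pos) auto
    also have "ln (e \<omega> * g) = ln (e \<omega>) + ln g" using e0 g by (intro ln_mult_pos)
    finally show eq: "- ln (logistic (e \<omega>) x * (1 - logistic (e \<omega>) x)) = U \<omega>"
      by (simp add: U_def \<zeta>_def)
    have "ln (logistic (e \<omega>) x * (1 - logistic (e \<omega>) x)) \<le> ln 1"
      using l le_quarter[of "logistic (e \<omega>) x"] by (intro ln_mono) auto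
    then show "0 \<le> U \<omega>" using eq by simp
  qed
  have iU: "integrable M U"
    unfolding U_def[abs_def] using g
    by (intro Bochner_Integration.integrable_add Bochner_Integration.integrable_diff
        Bochner_Integration.integrable_minus il integrable_\<zeta> integrable_const) auto
  have "T \<Phi> x = (\<integral>\<^sup>+ \<omega>. ennreal (U \<omega>) \<partial>M)"
    unfolding P_eq[OF x \<Phi>_measurable] \<Phi>_def by (intro nn_integral_cong) (simp add: U)
  also have "\<dots> = ennreal (expectation U)"
    using iU U(2) by (intro nn_integral_eq_integral AE_I2)
  also have EU: "expectation U = - \<gamma> - ln g + h g"
    unfolding U_def[abs_def] \<gamma>_def h_def using g il integrable_\<zeta>[of g] by (simp add: prob_space)
  finally show "T \<Phi> x = ennreal (- \<gamma> - ln (x * (1 - x)) + h (x * (1 - x)))" by (simp add: g_def)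
  have "0 \<le> expectation U" using U(2) by (intro Bochner_Integration.integral_nonneg)
  then show "0 \<le> - \<gamma> - ln (x * (1 - x)) + h (x * (1 - x))" using EU by (simp add: g_def)
qed

text \<open>Near the ends of (0,1), \<open>h\<close> is at most half of \<gamma>, which leaves a
  drift of at most - \<gamma>/2. Elsewhere the bound \<open>h (1/4)\<close> is paid for by the
  indicator.\<close>

lemma drift:
  assumes g0: "0 < g0" "g0 \<le> 1/4" "h g0 \<le> \<gamma> / 2" and x: "x \<in> {0<..<1}"
  shows "T \<Phi> x + ennreal (\<gamma> / 2)
    \<le> \<Phi> x + ennreal (h (1/4)) * indicator {x. 0 < x \<and> x < 1 \<and> g0 \<le> x * (1 - x)} x"
proof -
  define g where "g = x * (1 - x)"
  have g: "0 < g" "g \<le> 1/4" using x le_quarter by (auto simp: g_def)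
  have \<gamma>: "0 < \<gamma>" using log_pos by (simp add: \<gamma>_def)
  have lg: "0 \<le> - ln g" using g by simp
  have "T \<Phi> x + ennreal (\<gamma> / 2) = ennreal (- \<gamma> - ln g + h g + \<gamma> / 2)"
    unfolding P_\<Phi>(1)[OF x, folded g_def] using P_\<Phi>(2)[OF x, folded g_def] \<gamma>
    by (intro ennreal_plus[symmetric]) auto
  also have "\<dots> \<le> ennreal (- ln g + h (1/4) * indicator {x. 0 < x \<and> x < 1 \<and> g0 \<le> x * (1 - x)} x)"
  proof (cases "g0 \<le> g")
    case True
    then show ?thesis using h_mono[of g "1/4"] g x \<gamma> by (intro ennreal_leI) (simp add: g_def)
  next
    case False
    then show ?thesis using h_mono[of g g0] g g0 x \<gamma> by (intro ennreal_leI) (simp add: g_def)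
  qed
  also have "\<dots> = \<Phi> x + ennreal (h (1/4)) * indicator {x. 0 < x \<and> x < 1 \<and> g0 \<le> x * (1 - x)} x"
    unfolding \<Phi>_def g_def[symmetric] using lg h_nonneg[of "1/4"]
    by (auto simp: indicator_def ennreal_plus[symmetric] add.commute simp del: ennreal_plus)
  finally show ?thesis .
qed

section \<open>Accessibility of the regeneration set\<close>

definition u0 :: real where "u0 = (a + b) / 2"

lemma u0: "a < u0" "u0 < b" using ab by (auto simp: u0_def)

text \<open>A locally uniform bound rather than mere positivity: the neighbourhood is what can be
  pulled back by one step and what provides the open cover of a compact set.\<close>

definition accessible :: "(real \<Rightarrow> ennreal) \<Rightarrow> real \<Rightarrow> bool" where
  "accessible s x \<longleftrightarrow> (\<exists>n \<sigma> V. 0 < \<sigma> \<and> open V \<and> x \<in> V \<and> (\<forall>y\<in>V \<inter> {0<..<1}. \<sigma> \<le> (T ^^ n) s y))"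

text \<open>By joint continuity, parameters near \<open>u\<close> send points near \<open>x\<close>
  into the good neighbourhood, and such parameters occur with positive probability \<open>q\<close>.
  Contrapositively, the inaccessible points form a set invariant under all parameters in
  \<open>{a<..<b}\<close>.\<close>

lemma accessible_step:
  assumes s: "s \<in> borel_measurable S" and u: "u \<in> {a<..<b}" and g: "accessible s (logistic u x)"
  shows "accessible s x"
proof -
  from g obtain n \<sigma> V where V: "0 < \<sigma>" "open V" "logistic u x \<in> V"
      "\<And>y. y \<in> V \<inter> {0<..<1} \<Longrightarrow> \<sigma> \<le> (T ^^ n) s y"
    unfolding accessible_def by blast
  define W where "W = (\<lambda>z. logistic (fst z) (snd z)) -` V"
  have "open W" unfolding W_def logistic_def
    by (intro open_vimage V(2) continuous_intros)
  moreover have "(u, x) \<in> W" using V by (simp add: W_def)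
  ultimately obtain A B where AB: "open A" "open B" "(u, x) \<in> A \<times> B" "A \<times> B \<subseteq> W"
    using open_prod_elim by blast
  define q where "q = emeasure M {\<omega> \<in> space M. e \<omega> \<in> A}"
  have q: "0 < q" unfolding q_def using AB by (intro hit_pos[OF u]) auto
  have meas: "(T ^^ n) s \<in> borel_measurable S" by (intro p.pow_measurable s)
  have "\<sigma> * q \<le> (T ^^ Suc n) s y" if y: "y \<in> B \<inter> {0<..<1}" for y
  proof -
    have "\<sigma> * q = (\<integral>\<^sup>+ \<omega>. \<sigma> * indicator {\<omega> \<in> space M. e \<omega> \<in> A} \<omega> \<partial>M)"
    proof -
      have [measurable]: "A \<in> sets borel" using AB(1) by simp
      have "{\<omega> \<in> space M. e \<omega> \<in> A} \<in> events" by measurable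
      then show ?thesis unfolding q_def by (simp add: nn_integral_cmult_indicator)
    qed
    also have "\<dots> \<le> (\<integral>\<^sup>+ \<omega>. (T ^^ n) s (logistic (e \<omega>) y) \<partial>M)"
    proof (rule nn_integral_mono)
      fix \<omega> assume \<omega>: "\<omega> \<in> space M"
      show "\<sigma> * indicator {\<omega> \<in> space M. e \<omega> \<in> A} \<omega> \<le> (T ^^ n) s (logistic (e \<omega>) y)"
      proof (cases "e \<omega> \<in> A")
        case True
        then have "(e \<omega>, y) \<in> W" using AB y by blast
        then have "\<sigma> \<le> (T ^^ n) s (logistic (e \<omega>) y)"
          using logistic_in_unit_interval[OF e_range[OF \<omega>], of y] y
          by (intro V(4)) (auto simp: W_def)
        then show ?thesis using True \<omega> by simp
      qed simp
    qed
    also have "\<dots> = (T ^^ Suc n) s y" using P_eq[OF _ meas, of y] y by simp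
    finally show ?thesis .
  qed
  then show ?thesis unfolding accessible_def
    using AB q V(1) by (intro exI[of _ "Suc n"] exI[of _ "\<sigma> * q"] exI[of _ B])
      (auto simp: ennreal_zero_less_mult_iff)
qed

lemma ex_cluster_point:
  obtains z r where "z \<in> {0<..<1}" "strict_mono (r :: nat \<Rightarrow> nat)"
    "(\<lambda>n. (logistic u0 ^^ r n) (1/2)) \<longlonglongrightarrow> z"
proof -
  have half: "1/2 \<in> {0<..<1::real}" by simp
  obtain m' M' where mM: "0 < m'" "m' \<le> 1/2" "1/2 \<le> M'" "M' < (1::real)"
    and trap: "\<And>y v. y \<in> {m'..M'} \<Longrightarrow> v \<in> {a..b} \<Longrightarrow> logistic v y \<in> {m'..M'}"
    using logistic_trap[OF ab(1,3) half] by blast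
  have "(logistic u0 ^^ n) (1/2) \<in> {m'..M'}" for n
  proof (induction n)
    case (Suc n)
    then show ?case using trap[of "(logistic u0 ^^ n) (1/2)" u0] u0 by simp
  qed (use mM in simp)
  then obtain z r where "z \<in> {m'..M'}" "strict_mono (r :: nat \<Rightarrow> nat)"
      "((\<lambda>n. (logistic u0 ^^ n) (1/2)) \<circ> r) \<longlonglongrightarrow> z"
    using seq_compactE[OF compact_imp_seq_compact[OF compact_Icc], of "\<lambda>n. (logistic u0 ^^ n) (1/2)" m' M']
    by blast
  then show thesis using mM by (intro that[of z r]) (auto simp: comp_def simp del: funpow.simps)
qed

text \<open>If inaccessible points existed, the critical orbit of \<open>u0\<close> would enter
  their set and stay there, although it visits the accessible neighbourhood \<open>N\<close> of its
  cluster point at arbitrarily late times.\<close>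

lemma all_accessible:
  assumes s: "s \<in> borel_measurable S" and z: "strict_mono (r :: nat \<Rightarrow> nat)"
      "(\<lambda>n. (logistic u0 ^^ r n) (1/2)) \<longlonglongrightarrow> z"
    and N: "open N" "z \<in> N" "\<And>y. y \<in> N \<Longrightarrow> accessible s y"
    and x: "x \<in> {0<..<1}"
  shows "accessible s x"
proof (rule ccontr)
  assume "\<not> accessible s x"
  define R where "R = {x \<in> {0<..<1}. \<not> accessible s x}"
  have inv: "logistic v y \<in> R" if "y \<in> R" "v \<in> {a<..<b}" for y v
    using accessible_step[OF s that(2), of y] that logistic_in_unit_interval[of v y] ab by (auto simp: R_def)
  have "\<exists>n. (logistic u0 ^^ n) (1/2) \<in> R"
  proof (rule critical_orbit_enters)
    show "1 < a" "a < u0" "u0 < b" "b < 4" using ab u0 by auto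
    show "R \<subseteq> {0<..<1}" "R \<noteq> {}" using x \<open>\<not> accessible s x\<close> by (auto simp: R_def)
  qed (rule inv)
  then obtain n where n: "(logistic u0 ^^ n) (1/2) \<in> R" by blast
  have tail: "(logistic u0 ^^ (k + n)) (1/2) \<in> R" for k
  proof (induction k)
    case (Suc k)
    then show ?case using inv[of "(logistic u0 ^^ (k + n)) (1/2)" u0] u0 by simp
  qed (simp add: n)
  have "eventually (\<lambda>k. (logistic u0 ^^ r k) (1/2) \<in> N) sequentially"
    using topological_tendstoD[OF z(2) N(1,2)] .
  then obtain k where k: "\<And>j. j \<ge> k \<Longrightarrow> (logistic u0 ^^ r j) (1/2) \<in> N"
    unfolding eventually_sequentially by blast
  have "n \<le> r (max k n)" using seq_suble[OF z(1), of "max k n"] by simp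
  then have "(logistic u0 ^^ r (max k n)) (1/2) \<in> R" using tail[of "r (max k n) - n"] by simp
  moreover have "(logistic u0 ^^ r (max k n)) (1/2) \<in> N" by (rule k) simp
  ultimately show False using N(3) by (auto simp: R_def)
qed

lemma petite_compact:
  assumes accessible: "\<And>x. x \<in> K \<Longrightarrow> accessible s x" and K: "compact K" "K \<subseteq> {0<..<1}"
  shows "\<exists>\<sigma> m. 0 < \<sigma> \<and> \<sigma> < \<top> \<and> (\<forall>x\<in>K. \<sigma> \<le> (\<Sum>j\<le>m. (T ^^ j) s x))"
proof -
  have "\<forall>x\<in>K. \<exists>n \<sigma> V. 0 < \<sigma> \<and> open V \<and> x \<in> V \<and> (\<forall>y\<in>V \<inter> {0<..<1}. \<sigma> \<le> (T ^^ n) s y)"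
    using accessible unfolding accessible_def by blast
  then obtain n \<sigma> V where nV: "\<And>x. x \<in> K \<Longrightarrow> 0 < \<sigma> x \<and> open (V x) \<and> x \<in> V x \<and>
      (\<forall>y\<in>V x \<inter> {0<..<1}. \<sigma> x \<le> (T ^^ n x) s y)"
    by metis
  have "K \<subseteq> (\<Union>x\<in>K. V x)" using nV by blast
  then obtain X where X: "X \<subseteq> K" "finite X" "K \<subseteq> (\<Union>x\<in>X. V x)"
    using compactE_image[OF K(1), of K V] nV by metis
  \<comment> \<open>The inserted 1 keeps the minimum defined for an empty cover and makes it
    finite.\<close>
  define \<sigma>' where "\<sigma>' = Min (insert 1 (\<sigma> ` X))"
  define m where "m = Max (insert 0 (n ` X))"
  have "\<sigma>' \<le> 1" unfolding \<sigma>'_def using X by (intro Min_le) auto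
  then have "\<sigma>' < \<top>" by (rule order.strict_trans1) simp
  moreover have "0 < \<sigma>'" unfolding \<sigma>'_def using X nV by (subst Min_gr_iff) auto
  moreover have "\<sigma>' \<le> (\<Sum>j\<le>m. (T ^^ j) s y)" if "y \<in> K" for y
  proof -
    from X(3) that obtain x where x: "x \<in> X" "y \<in> V x" by blast
    have "n x \<le> m" unfolding m_def using X x by (intro Max_ge) auto
    have "\<sigma>' \<le> \<sigma> x" unfolding \<sigma>'_def using X x by (intro Min_le) auto
    also have "\<dots> \<le> (T ^^ n x) s y" using nV[of x] X x K that by blast
    also have "\<dots> \<le> (\<Sum>j\<le>m. (T ^^ j) s y)"
      using \<open>n x \<le> m\<close> by (intro member_le_sum) auto
    finally show ?thesis .
  qed
  ultimately show ?thesis by blast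
qed

section \<open>Local minorization by a uniform law\<close>

definition lo :: "real \<Rightarrow> real" where "lo z = (a + u0) / 2 * (z * (1 - z))"
definition hi :: "real \<Rightarrow> real" where "hi z = (u0 + b) / 2 * (z * (1 - z))"
text \<open>The points \<open>lo z\<close> and \<open>hi z\<close> are images of \<open>z\<close>
  under parameters halfway between \<open>a\<close> and \<open>u0\<close> and between
  \<open>u0\<close> and \<open>b\<close>. The slack on both sides lets every \<open>y\<close> near
  \<open>z\<close> still cover the whole interval between them with parameters from
  \<open>{a<..<b}\<close>.\<close>

definition nbhd :: "real \<Rightarrow> real set" where
  "nbhd z = {y \<in> {0<..<1}. a * (y * (1 - y)) < lo z \<and> hi z < b * (y * (1 - y))}"
definition regen_law :: "real \<Rightarrow> real measure" where
  "regen_law z = restrict_space (uniform_measure lborel {lo z <..< hi z}) {0<..<1}"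
text \<open>The factor \<open>hi z - lo z\<close> converts the density bound \<open>c\<close> into a
  multiple of the normalised uniform law.\<close>

definition regen_weight :: "real \<Rightarrow> real \<Rightarrow> ennreal" where
  "regen_weight z y = ennreal (c * (hi z - lo z)) * indicator (nbhd z) y"
definition residual :: "real \<Rightarrow> real \<Rightarrow> real measure" where
  "residual z y = diff_measure (p y) (scale_measure (regen_weight z y) (regen_law z))"

context
  fixes z :: real assumes z: "z \<in> {0<..<1}"
begin

lemma lo_hi: "0 < lo z" "lo z < hi z" "hi z < 1"
proof -
  have g: "0 < z * (1 - z)" using z by simp
  show "0 < lo z" unfolding lo_def using ab u0 by (intro mult_pos_pos[OF _ g]) simp
  show "lo z < hi z" unfolding lo_def hi_def using g ab by (intro mult_strict_right_mono) auto
  have "hi z \<le> (u0 + b) / 2 * (1/4)" unfolding hi_def using ab u0 by (intro mult_left_mono le_quarter) auto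
  then show "hi z < 1" using ab u0 by simp
qed

lemma nbhd_open: "open (nbhd z)"
proof -
  have "nbhd z = {0<..<1} \<inter> {y. a * (y * (1 - y)) < lo z} \<inter> {y. hi z < b * (y * (1 - y))}"
    by (auto simp: nbhd_def)
  also have "open \<dots>" by (intro open_Int open_Collect_less continuous_intros open_greaterThanLessThan)
  finally show ?thesis .
qed

lemma z_nbhd: "z \<in> nbhd z"
proof -
  have g: "0 < z * (1 - z)" using z by simp
  have "a * (z * (1 - z)) < lo z" "hi z < b * (z * (1 - z))"
    unfolding lo_def hi_def using u0 by (intro mult_strict_right_mono g; simp)+
  then show ?thesis using z by (simp add: nbhd_def)
qed

lemma weight_measurable: "regen_weight z \<in> borel_measurable S"
  unfolding regen_weight_def[abs_def] using nbhd_open by (intro measurable_unit_interval) measurable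

lemma sets_regen_law: "sets (regen_law z) = sets S"
  unfolding regen_law_def unit_interval_space_def by (intro sets_restrict_space_cong) simp

lemma emeasure_regen_law:
  assumes "B \<in> sets S"
  shows "emeasure (regen_law z) B = emeasure lborel ({lo z <..< hi z} \<inter> B) / ennreal (hi z - lo z)"
  unfolding regen_law_def using assms lo_hi
  by (subst emeasure_restrict_space) (auto simp: sets_unit_interval)

lemma regen_law_interval: "emeasure (regen_law z) {lo z <..< hi z} = 1"
  using lo_hi by (subst emeasure_regen_law) (auto simp: sets_unit_interval ennreal_divide_self)

lemma prob_regen_law: "prob_space (regen_law z)"
proof (rule prob_spaceI)
  have "space (regen_law z) = {0<..<1}"
    using sets_eq_imp_space_eq[OF sets_regen_law] by (simp add: space_unit_interval)
  moreover have "{lo z <..< hi z} \<inter> {0<..<1} = {lo z <..< hi z}" using lo_hi by auto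
  ultimately show "emeasure (regen_law z) (space (regen_law z)) = 1"
    using lo_hi by (simp add: emeasure_regen_law sets_unit_interval ennreal_divide_self)
qed

text \<open>Dividing the target set by \<open>g = y * (1 - y)\<close> gives a set of parameters
  inside \<open>{a<..<b}\<close>, where the law of \<open>e\<close> dominates \<open>c\<close> times
  Lebesgue measure.\<close>

lemma minorization:
  assumes y: "y \<in> {0<..<1}" and B: "B \<in> sets S"
  shows "regen_weight z y * emeasure (regen_law z) B \<le> emeasure (p y) B"
proof (cases "y \<in> nbhd z")
  case True
  define W where "W = {lo z <..< hi z}"
  define g where "g = y * (1 - y)"
  have g: "0 < g" "g \<le> 1/4" using y le_quarter by (auto simp: g_def)
  have N: "a * g < lo z" "hi z < b * g" using True by (auto simp: nbhd_def g_def)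
  have Bb: "B \<in> sets borel" using B by (simp add: sets_unit_interval)
  define A where "A = (\<lambda>v. v * g) -` (W \<inter> B)"
  have "(\<lambda>v. v * g) \<in> borel_measurable borel" by measurable
  moreover have "W \<inter> B \<in> sets borel" using Bb by (simp add: W_def)
  ultimately have "(\<lambda>v. v * g) -` (W \<inter> B) \<inter> space borel \<in> sets borel" by (rule measurable_sets)
  then have Ab: "A \<in> sets borel" by (simp add: A_def)
  have "A \<subseteq> {a<..<b}"
  proof
    fix v assume "v \<in> A"
    then have "a * g < v * g" "v * g < b * g" using N by (auto simp: A_def W_def)
    then show "v \<in> {a<..<b}" using g by simp
  qed
  have d: "0 < hi z - lo z" using lo_hi by simp
  have "regen_weight z y * emeasure (regen_law z) B
      = ennreal c * (ennreal (hi z - lo z) * (emeasure lborel (W \<inter> B) / ennreal (hi z - lo z)))"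
    using True c_pos d by (simp add: regen_weight_def emeasure_regen_law[OF B] W_def ennreal_mult mult.assoc)
  also have "ennreal (hi z - lo z) * (emeasure lborel (W \<inter> B) / ennreal (hi z - lo z)) = emeasure lborel (W \<inter> B)"
    using d by (simp add: ennreal_times_divide ennreal_mult_divide_eq mult.commute)
  also have "emeasure lborel (W \<inter> B) \<le> emeasure lborel A"
  proof -
    have "emeasure lborel (W \<inter> B) = (\<integral>\<^sup>+ w. indicator (W \<inter> B) w \<partial>lborel)" using Bb by (simp add: W_def)
    also have "\<dots> = ennreal \<bar>g\<bar> * (\<integral>\<^sup>+ v. indicator (W \<inter> B) (0 + g * v) \<partial>lborel)"
      using g Bb by (intro nn_integral_real_affine) (auto simp: W_def)
    also have "(\<lambda>v. indicator (W \<inter> B) (0 + g * v)) = (indicator A :: real \<Rightarrow> ennreal)"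
      by (auto simp: A_def indicator_def fun_eq_iff mult.commute)
    also have "(\<integral>\<^sup>+ v. indicator A v \<partial>lborel) = emeasure lborel A" using Ab by simp
    \<comment> \<open>Scaling by \<open>g \<le> 1/4\<close> only shrinks lengths. Dropping this
      factor makes the weight constant on the neighbourhood.\<close>
    also have "ennreal \<bar>g\<bar> * emeasure lborel A \<le> 1 * emeasure lborel A"
      using g by (intro mult_right_mono) auto
    finally show ?thesis by simp
  qed
  then have "ennreal c * emeasure lborel (W \<inter> B) \<le> ennreal c * emeasure lborel A" by (rule mult_left_mono) simp
  also have "\<dots> \<le> emeasure (distr M borel e) A" by (rule minor) fact+
  also have "\<dots> = emeasure M (e -` A \<inter> space M)" using Ab by (intro emeasure_distr) auto
  also have "\<dots> \<le> emeasure M ((\<lambda>\<omega>. e \<omega> * y * (1 - y)) -` B \<inter> space M)"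
    using measurable_sets[OF kernel_arg_measurable[OF y] B]
    by (intro emeasure_mono) (auto simp: A_def g_def mult.assoc)
  also have "\<dots> = emeasure (p y) B"
    unfolding logistic_kernel_def by (intro emeasure_distr[symmetric] kernel_arg_measurable y B)
  finally show ?thesis .
qed (simp add: regen_weight_def)

lemma emeasure_residual:
  assumes y: "y \<in> {0<..<1}" and B: "B \<in> sets S"
  shows "emeasure (residual z y) B = emeasure (p y) B - regen_weight z y * emeasure (regen_law z) B"
proof -
  interpret p: prob_space "p y" by (rule prob_space_p[OF y])
  interpret r: prob_space "regen_law z" by (rule prob_regen_law)
  have "finite_measure (scale_measure (regen_weight z y) (regen_law z))"
    by (rule finite_measureI) (auto simp: regen_weight_def ennreal_mult_eq_top_iff indicator_def)
  then show ?thesis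
    unfolding residual_def using B minorization[OF y]
    by (subst emeasure_diff_measure) (auto simp: sets_regen_law intro: p.finite_measure_axioms)
qed

lemma residual_kernel: "residual z \<in> S \<rightarrow>\<^sub>M subprob_algebra S"
proof (rule measurable_subprob_algebra)
  fix y assume "y \<in> space S"
  then have y: "y \<in> {0<..<1}" by (simp add: space_unit_interval)
  interpret p: prob_space "p y" by (rule prob_space_p[OF y])
  have sp: "space (residual z y) = space S"
    unfolding residual_def by (simp add: sets_eq_imp_space_eq[OF sets_p])
  show "sets (residual z y) = sets S" by (simp add: residual_def)
  show "subprob_space (residual z y)"
  proof (rule subprob_spaceI)
    have "emeasure (residual z y) (space S) \<le> emeasure (p y) (space S)"
      unfolding emeasure_residual[OF y sets.top] by (rule diff_le_self_ennreal)
    also have "\<dots> \<le> 1" by (rule p.subprob_emeasure_le_1)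
    finally show "emeasure (residual z y) (space (residual z y)) \<le> 1" using sp by simp
    show "space (residual z y) \<noteq> {}" using sp y by (auto simp: space_unit_interval)
  qed
next
  fix B assume B: "B \<in> sets S"
  have [measurable]: "regen_weight z \<in> borel_measurable S" by (rule weight_measurable)
  have [measurable]: "(\<lambda>y. emeasure (p y) B) \<in> borel_measurable S"
    using p_kernel B by (rule measurable_emeasure_kernel)
  have "(\<lambda>y. emeasure (p y) B - regen_weight z y * emeasure (regen_law z) B) \<in> borel_measurable S"
    by measurable
  then show "(\<lambda>y. emeasure (residual z y) B) \<in> borel_measurable S"
    by (subst measurable_cong[OF emeasure_residual]) (auto simp: space_unit_interval B)
qed

text \<open>The law lives on an interval bounded away from 0 and 1, where \<open>\<Phi>\<close> is
  bounded.\<close>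

lemma \<Phi>_regen_law: "(\<integral>\<^sup>+ x. \<Phi> x \<partial>regen_law z) < \<top>"
proof -
  interpret r: prob_space "regen_law z" by (rule prob_regen_law)
  have "AE x in regen_law z. x \<in> {lo z <..< hi z}"
    by (rule r.AE_prob_1) (simp add: measure_def regen_law_interval)
  then have "AE x in regen_law z. \<Phi> x \<le> ennreal (- ln (lo z * (1 - hi z)))"
  proof eventually_elim
    case (elim x)
    have "lo z * (1 - hi z) \<le> x * (1 - x)" using elim lo_hi by (intro mult_mono) auto
    then have "ln (lo z * (1 - hi z)) \<le> ln (x * (1 - x))" using lo_hi by (intro ln_mono) auto
    then show ?case unfolding \<Phi>_def by (intro ennreal_leI) simp
  qed
  then have "(\<integral>\<^sup>+ x. \<Phi> x \<partial>regen_law z) \<le> (\<integral>\<^sup>+ x. ennreal (- ln (lo z * (1 - hi z))) \<partial>regen_law z)"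
    by (rule nn_integral_mono_AE)
  also have "\<dots> < \<top>" by (simp add: r.emeasure_space_1)
  finally show ?thesis .
qed

end

lemma split_kernel_regen:
  assumes z: "z \<in> {0<..<1}"
  shows "split_kernel S p (residual z) (regen_weight z) (regen_law z)"
proof (intro split_kernel.intro split_kernel_axioms.intro subkernel.intro)
  show "p \<in> S \<rightarrow>\<^sub>M subprob_algebra S" by (rule p_kernel)
  show "residual z \<in> S \<rightarrow>\<^sub>M subprob_algebra S" by (rule residual_kernel[OF z])
  show "regen_weight z \<in> borel_measurable S" by (rule weight_measurable[OF z])
  show "prob_space (regen_law z)" by (rule prob_regen_law[OF z])
  show "sets (regen_law z) = sets S" by (rule sets_regen_law[OF z])
  fix x assume "x \<in> space S"
  then have x: "x \<in> {0<..<1}" by (simp add: space_unit_interval)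
  show "prob_space (p x)" by (rule prob_space_p[OF x])
  fix B assume B: "B \<in> sets S"
  show "emeasure (p x) B = emeasure (residual z x) B + regen_weight z x * emeasure (regen_law z) B"
    unfolding emeasure_residual[OF z x B]
    by (rule diff_add_cancel_ennreal[symmetric] ) (rule minorization[OF z x B])
qed

theorem ergodic:
  "\<exists>\<pi>. invariant_probability S p \<pi> \<and>
     (\<forall>\<pi>'. invariant_probability S p \<pi>' \<longrightarrow> \<pi>' = \<pi>) \<and>
     (\<forall>x\<in>{0<..<1}. (\<lambda>N. tv_dist S (cesaro_kernel S p N x) (measure \<pi>)) \<longlonglongrightarrow> 0)"
proof -
  obtain z r where z: "z \<in> {0<..<1}" "strict_mono (r :: nat \<Rightarrow> nat)"
      "(\<lambda>n. (logistic u0 ^^ r n) (1/2)) \<longlonglongrightarrow> z"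
    by (rule ex_cluster_point)
  let ?s = "regen_weight z"
  \<comment> \<open>The weight itself is constant and positive on the neighbourhood, so zero steps
    suffice.\<close>
  have near: "accessible ?s y" if "y \<in> nbhd z" for y
  proof -
    have "0 < ennreal (c * (hi z - lo z))" using c_pos lo_hi(2)[OF z(1)] by simp
    moreover have "ennreal (c * (hi z - lo z)) \<le> (T ^^ 0) ?s y'" if "y' \<in> nbhd z" for y'
      using that by (simp add: regen_weight_def)
    ultimately show ?thesis
      unfolding accessible_def using that nbhd_open[OF z(1)] by blast
  qed
  have accessible: "accessible ?s x" if "x \<in> {0<..<1}" for x
    by (rule all_accessible[OF weight_measurable[OF z(1)] z(2,3) nbhd_open[OF z(1)] z_nbhd[OF z(1)] near that])
  obtain g0 where g0: "0 < g0" "g0 \<le> 1/4" "h g0 \<le> \<gamma> / 2" using h_small by blast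
  define K where "K = {x. 0 < x \<and> x < 1 \<and> g0 \<le> x * (1 - x)}"
  \<comment> \<open>The closed description shows compactness; 0 and 1 drop out because
    \<open>g0\<close> is positive.\<close>
  have Keq: "K = {0..1} \<inter> {x. g0 \<le> x * (1 - x)}"
  proof (intro equalityI subsetI)
    fix x assume x: "x \<in> {0..1} \<inter> {x. g0 \<le> x * (1 - x)}"
    then have "x \<noteq> 0" "x \<noteq> 1" using g0(1) by auto
    then show "x \<in> K" using x by (auto simp: K_def)
  qed (auto simp: K_def)
  have cK: "compact K" unfolding Keq
    by (intro compact_Int_closed closed_Collect_le continuous_intros compact_Icc)
  have K01: "K \<subseteq> {0<..<1}" by (auto simp: K_def)
  have "\<exists>\<sigma> m. 0 < \<sigma> \<and> \<sigma> < \<top> \<and> (\<forall>x\<in>K. \<sigma> \<le> (\<Sum>j\<le>m. (T ^^ j) ?s x))"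
    by (rule petite_compact[OF accessible cK K01]) (use K01 in blast)
  then obtain \<sigma> m where \<sigma>: "0 < \<sigma>" "\<sigma> < \<top>" "\<And>x. x \<in> K \<Longrightarrow> \<sigma> \<le> (\<Sum>j\<le>m. (T ^^ j) ?s x)"
    by blast
  interpret drift_kernel S p "residual z" ?s "regen_law z" \<Phi> "ennreal (\<gamma> / 2)" "ennreal (h (1/4))" \<sigma> K m
  proof (intro drift_kernel.intro drift_kernel_axioms.intro)
    show "split_kernel S p (residual z) ?s (regen_law z)" by (rule split_kernel_regen[OF z(1)])
    show "\<Phi> \<in> borel_measurable S" by (rule \<Phi>_measurable)
    show "\<Phi> x < \<top>" for x by (simp add: \<Phi>_def)
    show "(\<integral>\<^sup>+ x. \<Phi> x \<partial>regen_law z) < \<top>" by (rule \<Phi>_regen_law[OF z(1)])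
    show "0 < ennreal (\<gamma> / 2)" using log_pos by (simp add: \<gamma>_def)
    show "K \<in> sets S" using cK K01 by (auto simp: sets_unit_interval intro: borel_compact)
    show "kop p \<Phi> x + ennreal (\<gamma> / 2) \<le> \<Phi> x + ennreal (h (1/4)) * indicator K x" if "x \<in> space S" for x
      using drift[OF g0, of x] that by (simp add: space_unit_interval K_def)
    show "0 < \<sigma>" "\<sigma> < \<top>" by (rule \<sigma>)+
    show "\<sigma> \<le> (\<Sum>j\<le>m. (kop p ^^ j) ?s x)" if "x \<in> K" for x by (rule \<sigma>(3)[OF that])
  qed simp_all
  obtain \<pi> where \<pi>: "invariant_probability S p \<pi>" using invariant_probability_exists by blast
  show ?thesis
  proof (intro exI[of _ \<pi>] conjI allI impI ballI)
    show "invariant_probability S p \<pi>" by (rule \<pi>)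
    show "\<pi>' = \<pi>" if "invariant_probability S p \<pi>'" for \<pi>'
      by (rule invariant_probability_unique[OF \<pi> that])
    show "(\<lambda>N. tv_dist S (cesaro_kernel S p N x) (measure \<pi>)) \<longlonglongrightarrow> 0" if "x \<in> {0<..<1}" for x
      by (rule cesaro_kernel_LIMSEQ[OF \<pi>]) (use that in \<open>simp add: space_unit_interval\<close>)
  qed
qed

end

theorem corollary2p2:
  fixes M :: "'w measure"
    and \<epsilon> :: "nat \<Rightarrow> 'w \<Rightarrow> real"
    and X :: "nat \<Rightarrow> 'w \<Rightarrow> real"
    and f :: "real \<Rightarrow> ennreal"
    and J :: "real set"
    and c :: real
  assumes "prob_space M"
    and "prob_space.indep_vars M (\<lambda>_. borel) \<epsilon> {1..}"
    and "\<And>n. n \<ge> 1 \<Longrightarrow> distr M borel (\<epsilon> n) = distr M borel (\<epsilon> 1)"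
    and "\<And>n \<omega>. n \<ge> 1 \<Longrightarrow> \<omega> \<in> space M \<Longrightarrow> \<epsilon> n \<omega> \<in> {0<..<4}"
    and "X 0 \<in> M \<rightarrow>\<^sub>M unit_interval_space"
    and "prob_space.indep_set M
           {X 0 -` B \<inter> space M | B. B \<in> sets unit_interval_space}
           (sigma_sets (space M) (\<Union>n\<in>{1..}. {\<epsilon> n -` B \<inter> space M | B. B \<in> sets borel}))"
    and "\<And>n \<omega>. \<omega> \<in> space M \<Longrightarrow> X (Suc n) \<omega> = \<epsilon> (Suc n) \<omega> * X n \<omega> * (1 - X n \<omega>)"
    and "ac_component_density (distr M borel (\<epsilon> 1)) f"
    and "emeasure (density lborel f) UNIV \<noteq> 0"
    and "is_interval J" and "\<exists>u\<in>J. \<exists>v\<in>J. u < v" and "J \<subseteq> {1<..<4}"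
    and "c > 0" and "AE y in lborel. y \<in> J \<longrightarrow> ennreal c \<le> f y"
    and "prob_space.expectation M (\<lambda>\<omega>. ln (\<epsilon> 1 \<omega>)) > 0"
    and "(\<integral>\<^sup>+ \<omega>. ennreal \<bar>ln (4 - \<epsilon> 1 \<omega>)\<bar> \<partial>M) < \<infinity>"
  shows "\<exists>\<pi>. invariant_probability unit_interval_space (logistic_kernel M (\<epsilon> 1)) \<pi> \<and>
           (\<forall>\<pi>'. invariant_probability unit_interval_space (logistic_kernel M (\<epsilon> 1)) \<pi>' \<longrightarrow> \<pi>' = \<pi>) \<and>
           (\<forall>x\<in>{0<..<1}.
              (\<lambda>N. tv_dist unit_interval_space
                     (cesaro_kernel unit_interval_space (logistic_kernel M (\<epsilon> 1)) N x)
                     (measure \<pi>)) \<longlonglongrightarrow> 0)"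
proof -
  interpret prob_space M by fact
  have e_meas: "\<epsilon> 1 \<in> borel_measurable M"
    using assms(2) unfolding indep_vars_def by auto
  \<comment> \<open>Two points of \<open>J\<close> are chosen instead of its ends, so the strict
    bounds hold even if \<open>J\<close> reaches up to 1 or 4.\<close>
  obtain a b where ab: "a \<in> J" "b \<in> J" "a < b" using assms(11) by blast
  have "a \<in> {1<..<4}" "b \<in> {1<..<4}" using ab assms(12) by blast+
  then have ab14: "1 < a" "b < 4" by auto
  have sub: "{a<..<b} \<subseteq> J"
    using assms(10) ab unfolding is_interval_1 by (meson greaterThanLessThan_iff less_imp_le subsetI)
  obtain \<nu> where f: "f \<in> borel_measurable borel"
      and dec: "\<And>B. B \<in> sets borel \<Longrightarrow>
        emeasure (distr M borel (\<epsilon> 1)) B = emeasure (density lborel f) B + emeasure \<nu> B"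
    using assms(8) unfolding ac_component_density_def by blast
  \<comment> \<open>The density bound is integrated over \<open>B\<close>; the component singular to
    Lebesgue measure can only add mass.\<close>
  have minor: "ennreal c * emeasure lborel B \<le> emeasure (distr M borel (\<epsilon> 1)) B"
    if B: "B \<in> sets borel" "B \<subseteq> {a<..<b}" for B
  proof -
    have "ennreal c * emeasure lborel B = (\<integral>\<^sup>+ y. ennreal c * indicator B y \<partial>lborel)"
      using B by (simp add: nn_integral_cmult_indicator)
    also have "\<dots> \<le> (\<integral>\<^sup>+ y. f y * indicator B y \<partial>lborel)"
    proof (rule nn_integral_mono_AE)
      show "AE y in lborel. ennreal c * indicator B y \<le> f y * indicator B y"
        using assms(14)
      proof eventually_elim
        case (elim y)
        then show ?case using B(2) sub by (cases "y \<in> B") auto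
      qed
    qed
    also have "\<dots> = emeasure (density lborel f) B"
      using B f by (subst emeasure_density) auto
    also have "\<dots> \<le> emeasure (distr M borel (\<epsilon> 1)) B" using dec[OF B(1)] by simp
    finally show ?thesis .
  qed
  interpret random_logistic M "\<epsilon> 1" a b c
    by unfold_locales (use e_meas assms(4)[of 1] ab ab14 assms(13,15,16) minor in auto)
  show ?thesis by (rule ergodic)
qed

end
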